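(* Let the group $G$ act on the hyperbolic space $X$, let $o\in X$, and let $Q\ge0$. Then there exist $K>0$, a hyperbolic space $Y$ with a cobounded $G$-action, and a $G$-equivariant coarsely Lipschitz map $\pi:X\to Y$ such that $\pi|_Z$ is a $(K,K)$-quasi-isometric embedding for every $Q$-quasiconvex subspace $Z$ of $X$ with $Z\subset G\cdot o$. Moreover, there exists $D$ such that for any geodesic $[x,y]$ in $X$, the image $\pi([x,y])$ lies at Hausdorff distance at most $D$ from any geodesic of $Y$ with endpoints $\pi(x),\pi(y)$.
   Context: A hyperbolic space is a geodesic Gromov hyperbolic metric space (not necessarily proper); actions on hyperbolic spaces are by isometries. An action on $Y$ is cobounded if some orbit is at finite Hausdorff distance from $Y$. A subset $Z\subset X$ is $Q$-quasiconvex if every geodesic of $X$ connecting two points of $Z$ lies in the $Q$-neighbourhood of $Z$. A map $f:(X,d_X)\to(Y,d_Y)$ is coarsely Lipschitz if there is $L$ with $d_Y(f(a),f(b))\le L\,d_X(a,b)+L$ for all $a,b$; it is a $(K,K)$-quasi-isometric embedding if $\frac1K d_X(a,b)-K\le d_Y(f(a),f(b))\le K d_X(a,b)+K$ for all $a,b$ (a subset $Z$ is given the restricted metric of $X$). *)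

theory Defs
  imports "HOL-Analysis.Abstract_Metric_Spaces" "HOL-Library.Extended_Nonnegative_Real"
    "HOL-Algebra.Group_Action"
begin

definition geodesic_between :: "'a metric \<Rightarrow> 'a \<Rightarrow> 'a \<Rightarrow> 'a set \<Rightarrow> bool" where
  "geodesic_between X x y S \<longleftrightarrow>
     (\<exists>(\<gamma> :: real \<Rightarrow> 'a) l. 0 \<le> l \<and> \<gamma> ` {0..l} \<subseteq> mspace X \<and>
        (\<forall>s\<in>{0..l}. \<forall>t\<in>{0..l}. mdist X (\<gamma> s) (\<gamma> t) = \<bar>s - t\<bar>) \<and>
        \<gamma> 0 = x \<and> \<gamma> l = y \<and> S = \<gamma> ` {0..l})"

definition geodesic_metric :: "'a metric \<Rightarrow> bool" where
  "geodesic_metric X \<longleftrightarrow>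
     (\<forall>x\<in>mspace X. \<forall>y\<in>mspace X. \<exists>S. geodesic_between X x y S)"

definition gromov_product :: "'a metric \<Rightarrow> 'a \<Rightarrow> 'a \<Rightarrow> 'a \<Rightarrow> real" where
  "gromov_product X w x y = (mdist X x w + mdist X y w - mdist X x y) / 2"

definition gromov_hyperbolic :: "'a metric \<Rightarrow> bool" where
  "gromov_hyperbolic X \<longleftrightarrow>
     (\<exists>\<delta>. \<forall>w\<in>mspace X. \<forall>x\<in>mspace X. \<forall>y\<in>mspace X. \<forall>z\<in>mspace X.
        min (gromov_product X w x y) (gromov_product X w y z) - \<delta> \<le> gromov_product X w x z)"

definition hyperbolic_space :: "'a metric \<Rightarrow> bool" where
  "hyperbolic_space X \<longleftrightarrow> geodesic_metric X \<and> gromov_hyperbolic X"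

text \<open>Distances to sets take values in the extended nonnegative reals, so that the distance from a
  point to the empty set is infinite.\<close>

definition dist_to_set :: "'a metric \<Rightarrow> 'a \<Rightarrow> 'a set \<Rightarrow> ennreal" where
  "dist_to_set X x A = (INF a\<in>A. ennreal (mdist X x a))"

definition hausdorff_dist :: "'a metric \<Rightarrow> 'a set \<Rightarrow> 'a set \<Rightarrow> ennreal" where
  "hausdorff_dist X A B = max (SUP a\<in>A. dist_to_set X a B) (SUP b\<in>B. dist_to_set X b A)"

text \<open>Neighbourhoods are closed: for radius 0 an open one would be empty.\<close>

definition neighbourhood :: "'a metric \<Rightarrow> real \<Rightarrow> 'a set \<Rightarrow> 'a set" where
  "neighbourhood X r A = {x \<in> mspace X. dist_to_set X x A \<le> ennreal r}"

definition quasiconvex :: "'a metric \<Rightarrow> real \<Rightarrow> 'a set \<Rightarrow> bool" where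
  "quasiconvex X Q Z \<longleftrightarrow> Z \<subseteq> mspace X \<and>
     (\<forall>x\<in>Z. \<forall>y\<in>Z. \<forall>S. geodesic_between X x y S \<longrightarrow> S \<subseteq> neighbourhood X Q Z)"

definition isometric_action ::
    "('g, 'm) monoid_scheme \<Rightarrow> 'a metric \<Rightarrow> ('g \<Rightarrow> 'a \<Rightarrow> 'a) \<Rightarrow> bool" where
  "isometric_action G X \<phi> \<longleftrightarrow> group_action G (mspace X) \<phi> \<and>
     (\<forall>g\<in>carrier G. \<forall>x\<in>mspace X. \<forall>y\<in>mspace X. mdist X (\<phi> g x) (\<phi> g y) = mdist X x y)"

definition cobounded_action ::
    "('g, 'm) monoid_scheme \<Rightarrow> 'a metric \<Rightarrow> ('g \<Rightarrow> 'a \<Rightarrow> 'a) \<Rightarrow> bool" where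
  "cobounded_action G X \<phi> \<longleftrightarrow> isometric_action G X \<phi> \<and>
     (\<exists>x\<in>mspace X. hausdorff_dist X (orbit G \<phi> x) (mspace X) < \<infinity>)"

definition equivariant ::
    "('g, 'm) monoid_scheme \<Rightarrow> 'a metric \<Rightarrow> ('g \<Rightarrow> 'a \<Rightarrow> 'a) \<Rightarrow> ('g \<Rightarrow> 'b \<Rightarrow> 'b) \<Rightarrow> ('a \<Rightarrow> 'b) \<Rightarrow> bool" where
  "equivariant G X \<phi> \<psi> f \<longleftrightarrow> (\<forall>g\<in>carrier G. \<forall>x\<in>mspace X. f (\<phi> g x) = \<psi> g (f x))"

definition coarsely_lipschitz :: "'a metric \<Rightarrow> 'b metric \<Rightarrow> ('a \<Rightarrow> 'b) \<Rightarrow> bool" where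
  "coarsely_lipschitz X Y f \<longleftrightarrow> f \<in> mspace X \<rightarrow> mspace Y \<and>
     (\<exists>L. \<forall>a\<in>mspace X. \<forall>b\<in>mspace X. mdist Y (f a) (f b) \<le> L * mdist X a b + L)"

definition quasi_isometric_embedding ::
    "real \<Rightarrow> 'a metric \<Rightarrow> 'b metric \<Rightarrow> ('a \<Rightarrow> 'b) \<Rightarrow> bool" where
  "quasi_isometric_embedding K X Y f \<longleftrightarrow> f \<in> mspace X \<rightarrow> mspace Y \<and>
     (\<forall>a\<in>mspace X. \<forall>b\<in>mspace X.
        (1 / K) * mdist X a b - K \<le> mdist Y (f a) (f b) \<and>
        mdist Y (f a) (f b) \<le> K * mdist X a b + K)"

end

theory Submission imports Defs begin

text \<open>
  The space \<open>Y\<close> is obtained by coning off every geodesic of \<open>X\<close> that stays far from the orbit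
  \<open>A = G \<cdot> x0\<close>. Let \<open>U\<close> be the set of points at distance more than \<open>R\<close> from \<open>A\<close>, and join two points
  of \<open>X\<close> by an edge if they are at distance at most 1 or are the ends of a geodesic inside \<open>U\<close>.
  The argument compares \<open>X\<close> with the resulting graph distance, called \<open>edist\<close>.

  Additivity. If \<open>q\<close> lies on a geodesic from \<open>x\<close> to \<open>y\<close> in \<open>X\<close>, then \<open>edist x q + edist q y\<close> exceeds
  \<open>edist x y\<close> by at most a constant (\<open>edist_additive_on_path\<close>); this holds for every region \<open>U\<close>.
  Project a shortest chain from \<open>x\<close> to \<open>y\<close> to the geodesic. An edge that moves the projection by more
  than \<open>\<delta>\<close> fellow-travels the geodesic, so its ends are near the geodesic in the graph
  (\<open>edge_pos_step\<close>). Along a stretch of \<open>2\<^sup>k\<close> edges far from the geodesic the total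
  displacement is at most \<open>\<delta>\<close>, because bisecting the stretch loses only \<open>k \<delta>\<close> in the Gromov product
  (\<open>chain_passes_near\<close>, \<open>far_chain_contracts\<close>). With \<open>2\<^sup>k \<ge> 2 \<delta>\<close> a shortest chain gains nothing from
  a long excursion, and so it passes near \<open>q\<close> (\<open>chain_near_path\<close>).

  Hyperbolicity. Four points of \<open>X\<close> are coarsely spanned by a tree. Additivity transfers the tree
  to the graph distance, which therefore satisfies the four-point inequality
  (\<open>edist_four_point\<close>). Additivity also says that a geodesic of \<open>X\<close> maps to a set whose points
  coarsely realise equality in the triangle inequality, and in a hyperbolic space such a set is
  close to a geodesic.

  Coboundedness. A shortest path from a point to \<open>A\<close> stays in \<open>U\<close> until its last bounded piece, so
  every point is at bounded graph distance from \<open>A\<close> (\<open>edist_to_avoided_set\<close>).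

  Quasi-isometric embedding. A geodesic between two points of a \<open>Q\<close>-quasiconvex \<open>Z \<subseteq> A\<close> stays
  \<open>Q\<close>-close to \<open>A\<close>. For \<open>R\<close> large compared with \<open>Q\<close> and \<open>\<delta>\<close> no geodesic in \<open>U\<close> comes near it, so
  every edge moves the projection by at most \<open>\<delta> + 1\<close> (\<open>electrification_undistorted\<close>).

  A geodesic space. The vertices of the graph with \<open>edist\<close> are only coarsely geodesic. Instead of
  gluing in edges, embed them into a space of real functions. In a tree the distance functions to
  points, up to additive constants, contain with \<open>f\<close> and \<open>g\<close> all functions \<open>max (f - r) g\<close>, and
  these trace out a geodesic for the metric \<open>sup (f - g) + sup (g - f)\<close>. For a coarsely geodesic
  hyperbolic space take all functions satisfying the Lipschitz and four-point inequalities of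
  distance functions: this class is closed under maxima and shifts, hence geodesic
  (\<open>hull_geodesic_path\<close>), and every member is at bounded distance from an actual distance function
  (\<open>hull_near_point\<close>), so that hyperbolicity, the action and coboundedness carry over.
\<close>

section \<open>The four-point inequality and geodesics\<close>

definition four_point :: "'a set \<Rightarrow> ('a \<Rightarrow> 'a \<Rightarrow> real) \<Rightarrow> real \<Rightarrow> bool" where
  "four_point M d c \<longleftrightarrow> (\<forall>x\<in>M. \<forall>y\<in>M. \<forall>z\<in>M. \<forall>w\<in>M.
     d x z + d y w \<le> max (d x y + d z w) (d y z + d x w) + c)"

lemma four_pointD:
  assumes "four_point M d c" "x \<in> M" "y \<in> M" "z \<in> M" "w \<in> M"
  shows "d x z + d y w \<le> max (d x y + d z w) (d y z + d x w) + c"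
  using assms unfolding four_point_def by blast

lemma gromov_hyperbolic_iff_four_point:
  "gromov_hyperbolic X \<longleftrightarrow> (\<exists>c. four_point (mspace X) (mdist X) c)"
proof
  assume "gromov_hyperbolic X"
  then obtain \<delta> where *: "min (gromov_product X w x y) (gromov_product X w y z) - \<delta>
      \<le> gromov_product X w x z"
    if "w \<in> mspace X" "x \<in> mspace X" "y \<in> mspace X" "z \<in> mspace X" for w x y z
    unfolding gromov_hyperbolic_def by blast
  have "four_point (mspace X) (mdist X) (2 * \<delta>)"
    unfolding four_point_def
  proof (intro ballI)
    fix x y z w
    assume "x \<in> mspace X" "y \<in> mspace X" "z \<in> mspace X" "w \<in> mspace X"
    then show "mdist X x z + mdist X y w
        \<le> max (mdist X x y + mdist X z w) (mdist X y z + mdist X x w) + 2 * \<delta>"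
      using *[of w x y z] by (auto simp: gromov_product_def min_def max_def field_simps split: if_splits)
  qed
  then show "\<exists>c. four_point (mspace X) (mdist X) c" ..
next
  assume "\<exists>c. four_point (mspace X) (mdist X) c"
  then obtain c where c: "four_point (mspace X) (mdist X) c" ..
  have "min (gromov_product X w x y) (gromov_product X w y z) - c / 2 \<le> gromov_product X w x z"
    if "w \<in> mspace X" "x \<in> mspace X" "y \<in> mspace X" "z \<in> mspace X" for w x y z
    using four_pointD[OF c that(2,3,4,1)]
    by (auto simp: gromov_product_def min_def max_def field_simps split: if_splits)
  then show "gromov_hyperbolic X"
    unfolding gromov_hyperbolic_def by blast
qed

lemma four_point_nonneg:
  assumes "four_point (mspace X) (mdist X) c" "x \<in> mspace X"
  shows "0 \<le> c"
  using four_pointD[OF assms(1), of x x x x] assms(2) by simp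

definition geodesic_path :: "'a metric \<Rightarrow> (real \<Rightarrow> 'a) \<Rightarrow> real \<Rightarrow> bool" where
  "geodesic_path X \<gamma> l \<longleftrightarrow> 0 \<le> l \<and> \<gamma> ` {0..l} \<subseteq> mspace X \<and>
     (\<forall>s\<in>{0..l}. \<forall>t\<in>{0..l}. mdist X (\<gamma> s) (\<gamma> t) = \<bar>s - t\<bar>)"

lemma geodesic_between_iff_path:
  "geodesic_between X x y S \<longleftrightarrow>
     (\<exists>\<gamma> l. geodesic_path X \<gamma> l \<and> \<gamma> 0 = x \<and> \<gamma> l = y \<and> S = \<gamma> ` {0..l})"
  unfolding geodesic_between_def geodesic_path_def by blast

lemma geodesic_path_length:
  assumes "geodesic_path X \<gamma> l"
  shows "mdist X (\<gamma> 0) (\<gamma> l) = l"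
  using assms by (auto simp: geodesic_path_def)

lemma geodesic_path_mspace:
  assumes "geodesic_path X \<gamma> l" "0 \<le> t" "t \<le> l"
  shows "\<gamma> t \<in> mspace X"
  using assms by (auto simp: geodesic_path_def)

lemma geodesic_path_dist_left:
  assumes "geodesic_path X \<gamma> l" "0 \<le> t" "t \<le> l"
  shows "mdist X (\<gamma> 0) (\<gamma> t) = t"
  using assms by (auto simp: geodesic_path_def)

lemma geodesic_path_dist_right:
  assumes "geodesic_path X \<gamma> l" "0 \<le> t" "t \<le> l"
  shows "mdist X (\<gamma> t) (\<gamma> l) = l - t"
  using assms by (auto simp: geodesic_path_def)

lemma geodesic_between_sub:
  assumes "geodesic_path X \<gamma> l" "0 \<le> s" "s \<le> t" "t \<le> l"
  shows "geodesic_between X (\<gamma> s) (\<gamma> t) (\<gamma> ` {s..t})"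
proof -
  have "geodesic_path X (\<lambda>r. \<gamma> (s + r)) (t - s)"
    using assms by (auto simp: geodesic_path_def)
  moreover have "(\<lambda>r. \<gamma> (s + r)) ` {0..t - s} = \<gamma> ` {s..t}"
    using image_add_atLeastAtMost[of s 0 "t - s"] by (simp flip: image_image)
  ultimately show ?thesis
    unfolding geodesic_between_iff_path by (metis add.right_neutral add_diff_cancel_left'
        diff_add_cancel add.commute)
qed

lemma geodesic_between_sym:
  assumes "geodesic_between X x y S"
  shows "geodesic_between X y x S"
proof -
  obtain \<gamma> l where g: "geodesic_path X \<gamma> l" "\<gamma> 0 = x" "\<gamma> l = y" "S = \<gamma> ` {0..l}"
    using assms unfolding geodesic_between_iff_path by blast
  have "geodesic_path X (\<lambda>r. \<gamma> (l - r)) l"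
    using g(1) by (auto simp: geodesic_path_def)
  moreover have "(\<lambda>r. \<gamma> (l - r)) ` {0..l} = \<gamma> ` {0..l}"
    using image_diff_atLeastAtMost[of l 0 l] by (simp flip: image_image)
  ultimately show ?thesis
    unfolding geodesic_between_iff_path using g by (metis diff_self diff_zero)
qed

text \<open>In a tree the distance from \<open>q\<close> to a point of a segment is determined by the distances to the
  two ends, whichever gives more.\<close>

lemma dist_geodesic_point_le:
  assumes "four_point (mspace X) (mdist X) c" "geodesic_path X \<gamma> l" "0 \<le> t" "t \<le> l"
    and "q \<in> mspace X"
  shows "mdist X q (\<gamma> t) \<le> max (mdist X q (\<gamma> 0) - t) (mdist X q (\<gamma> l) - (l - t)) + c"
proof -
  have l: "0 \<le> l" using assms by auto
  have "mdist X q (\<gamma> t) + mdist X (\<gamma> 0) (\<gamma> l)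
      \<le> max (mdist X q (\<gamma> 0) + mdist X (\<gamma> t) (\<gamma> l)) (mdist X (\<gamma> 0) (\<gamma> t) + mdist X q (\<gamma> l)) + c"
    using assms l by (intro four_pointD[OF assms(1)]) (auto intro: geodesic_path_mspace)
  then show ?thesis
    using geodesic_path_length[OF assms(2)] geodesic_path_dist_left[OF assms(2-4)]
      geodesic_path_dist_right[OF assms(2-4)] by auto
qed

lemma point_near_geodesic:
  assumes "four_point (mspace X) (mdist X) c" "geodesic_path X \<gamma> l" "q \<in> mspace X"
  obtains t where "0 \<le> t" "t \<le> l"
    "mdist X q (\<gamma> t) \<le> (mdist X q (\<gamma> 0) + mdist X q (\<gamma> l) - l) / 2 + c"
proof -
  \<comment> \<open>the position on the geodesic that balances the two terms of the previous bound\<close>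
  define t where "t = (mdist X q (\<gamma> 0) + l - mdist X q (\<gamma> l)) / 2"
  have l: "0 \<le> l" using assms by (auto simp: geodesic_path_def)
  have m: "\<gamma> 0 \<in> mspace X" "\<gamma> l \<in> mspace X"
    using l geodesic_path_mspace[OF assms(2)] by auto
  have "mdist X q (\<gamma> l) \<le> mdist X q (\<gamma> 0) + l" "mdist X q (\<gamma> 0) \<le> mdist X q (\<gamma> l) + l"
    using mdist_triangle[OF assms(3) m(1) m(2)] mdist_triangle[OF assms(3) m(2) m(1)]
      geodesic_path_length[OF assms(2)] mdist_commute[of X "\<gamma> l" "\<gamma> 0"] by auto
  then have t: "0 \<le> t" "t \<le> l" by (auto simp: t_def)
  show ?thesis
    using that[OF t] dist_geodesic_point_le[OF assms(1,2) t assms(3)]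
    by (auto simp: t_def max_def field_simps split: if_splits)
qed

lemma discrete_intermediate_value:
  fixes g :: "nat \<Rightarrow> 'b::linorder"
  assumes "g 0 \<le> t" "t \<le> g n" "0 < n"
  shows "\<exists>k<n. g k \<le> t \<and> t \<le> g (Suc k)"
  using assms(2,3)
proof (induction n)
  case (Suc n)
  show ?case
  proof (cases "t \<le> g n \<and> 0 < n")
    case True
    then show ?thesis using Suc.IH by (meson less_SucI)
  next
    case False
    then have "g n \<le> t" using assms(1) by (cases n) auto
    then show ?thesis using Suc.prems by blast
  qed
qed simp

section \<open>Electrification along a region\<close>

locale electrification =
  fixes X :: "'a metric" and \<delta> :: real and U :: "'a set"
  assumes geodesic: "geodesic_metric X"
    and hyperbolic: "four_point (mspace X) (mdist X) \<delta>"
    and delta_nonneg: "0 \<le> \<delta>"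
begin

abbreviation M :: "'a set" where "M \<equiv> mspace X"
abbreviation d :: "'a \<Rightarrow> 'a \<Rightarrow> real" where "d \<equiv> mdist X"

text \<open>A subsegment of a geodesic in \<open>U\<close> is again in \<open>U\<close>, so an edge makes any two points of the
  underlying geodesic adjacent: this is the cone over it.\<close>

definition edge :: "('a \<times> 'a) set" where
  "edge = {(u, v). u \<in> M \<and> v \<in> M \<and> (d u v \<le> 1 \<or> (\<exists>S. geodesic_between X u v S \<and> S \<subseteq> U))}"

definition edist :: "'a \<Rightarrow> 'a \<Rightarrow> nat" where
  "edist u v = (LEAST n. (u, v) \<in> edge ^^ n)"

lemma geodesic_exists:
  assumes "x \<in> M" "y \<in> M"
  obtains \<gamma> where "geodesic_path X \<gamma> (d x y)" "\<gamma> 0 = x" "\<gamma> (d x y) = y"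
  using assms geodesic unfolding geodesic_metric_def geodesic_between_iff_path
  by (metis geodesic_path_length)

lemma edge_mspace: "(u, v) \<in> edge \<Longrightarrow> u \<in> M \<and> v \<in> M"
  by (simp add: edge_def)

lemma edge_sym: "(u, v) \<in> edge \<Longrightarrow> (v, u) \<in> edge"
  using geodesic_between_sym by (fastforce simp: edge_def mdist_commute)

lemma edge_power_sym: "(u, v) \<in> edge ^^ n \<Longrightarrow> (v, u) \<in> edge ^^ n"
proof (induction n arbitrary: v)
  case (Suc n)
  then obtain w where "(u, w) \<in> edge ^^ n" "(w, v) \<in> edge" by auto
  then show ?case using Suc.IH edge_sym by (blast intro: relpow_Suc_I2)
qed simp

lemma edge_power_short:
  assumes "u \<in> M" "v \<in> M" "d u v \<le> real n"
  shows "(u, v) \<in> edge ^^ n"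
proof -
  obtain \<gamma> where g: "geodesic_path X \<gamma> (d u v)" "\<gamma> 0 = u" "\<gamma> (d u v) = v"
    using geodesic_exists assms by blast
  define f where "f i = \<gamma> (min (real i) (d u v))" for i :: nat
  have "(f i, f (Suc i)) \<in> edge" for i
    using g(1) by (auto simp: f_def edge_def geodesic_path_def)
  moreover have "f 0 = u" "f n = v" using g assms by (auto simp: f_def)
  ultimately show ?thesis by (auto simp: relpow_fun_conv)
qed

lemma edist_path: "u \<in> M \<Longrightarrow> v \<in> M \<Longrightarrow> (u, v) \<in> edge ^^ edist u v"
  unfolding edist_def using edge_power_short[of u v "nat \<lceil>d u v\<rceil>"]
  by (auto intro!: LeastI simp: of_nat_ceiling)

lemma edist_le_power: "(u, v) \<in> edge ^^ n \<Longrightarrow> edist u v \<le> n"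
  unfolding edist_def by (rule Least_le)

lemma edist_le:
  assumes "u \<in> M" "v \<in> M"
  shows "real (edist u v) \<le> d u v + 1"
proof -
  have "edist u v \<le> nat \<lceil>d u v\<rceil>"
    using assms by (intro edist_le_power edge_power_short) (auto simp: of_nat_ceiling)
  then show ?thesis using mdist_nonneg[of X u v] by linarith
qed

lemma edist_refl [simp]: "edist u u = 0"
  using edist_le_power[of u u 0] by simp

lemma edist_edge: "(u, v) \<in> edge \<Longrightarrow> edist u v \<le> 1"
  using edist_le_power[of u v 1] by simp

lemma edist_commute: "u \<in> M \<Longrightarrow> v \<in> M \<Longrightarrow> edist u v = edist v u"
  by (meson antisym edge_power_sym edist_le_power edist_path)

lemma edist_triangle:
  assumes "u \<in> M" "v \<in> M" "w \<in> M"
  shows "edist u w \<le> edist u v + edist v w"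
  using assms edist_path[of u v] edist_path[of v w]
  by (intro edist_le_power) (auto simp: relpow_add)

lemma edist_triangle_real:
  assumes "u \<in> M" "v \<in> M" "w \<in> M"
  shows "real (edist u w) \<le> real (edist u v) + real (edist v w)"
  using edist_triangle[OF assms] by linarith

lemma edist_geodesic_chain:
  assumes "x \<in> M" "y \<in> M"
  obtains u where "u 0 = x" "u (edist x y) = y"
    "\<And>i. i < edist x y \<Longrightarrow> (u i, u (Suc i)) \<in> edge"
    "\<And>i. i \<le> edist x y \<Longrightarrow> u i \<in> M"
    "\<And>i j. i \<le> j \<Longrightarrow> j \<le> edist x y \<Longrightarrow> edist (u i) (u j) = j - i"
proof -
  obtain u where u: "u 0 = x" "u (edist x y) = y"
    "\<And>i. i < edist x y \<Longrightarrow> (u i, u (Suc i)) \<in> edge"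
    using edist_path[OF assms] unfolding relpow_fun_conv by blast
  have m: "u i \<in> M" if "i \<le> edist x y" for i
    using that u assms(1) edge_mspace by (cases i) (auto simp: Suc_le_eq)
  have pow: "(u i, u (i + k)) \<in> edge ^^ k" if "i + k \<le> edist x y" for i k
    using that
  proof (induction k)
    case (Suc k)
    then show ?case using u(3)[of "i + k"] by auto
  qed simp
  have le: "edist (u i) (u j) \<le> j - i" if "i \<le> j" "j \<le> edist x y" for i j
    using pow[of i "j - i"] that by (auto intro: edist_le_power)
  have "edist (u i) (u j) = j - i" if ij: "i \<le> j" "j \<le> edist x y" for i j
  proof -
    have "edist x y \<le> edist x (u i) + (edist (u i) (u j) + edist (u j) y)"
      using ij edist_triangle[of x "u i" y] edist_triangle[of "u i" "u j" y] m assms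
      by fastforce
    then show ?thesis using le[of 0 i] le[of i j] le[of j "edist x y"] ij u by simp
  qed
  then show thesis using that u m by blast
qed

text \<open>The excess \<open>d u q + d v q - d u v\<close>, twice a Gromov product, measures how far \<open>q\<close> is from the
  geodesic underlying the edge, all of whose points are adjacent to \<open>u\<close>.\<close>

lemma edist_edge_to_near_point:
  assumes "(u, v) \<in> edge" "q \<in> M"
  shows "real (edist u q) \<le> d u q + d v q - d u v + \<delta> + 2"
proof -
  have uv: "u \<in> M" "v \<in> M" using assms edge_mspace by auto
  consider "d u v \<le> 1" | S where "geodesic_between X u v S" "S \<subseteq> U"
    using assms by (auto simp: edge_def)
  then show ?thesis
  proof cases
    case 1
    then show ?thesis
      using edist_le[OF uv(1) assms(2)] mdist_nonneg[of X v q] delta_nonneg by linarith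
  next
    case 2
    obtain \<gamma> l where g: "geodesic_path X \<gamma> l" "\<gamma> 0 = u" "\<gamma> l = v" "S = \<gamma> ` {0..l}"
      using 2 unfolding geodesic_between_iff_path by blast
    obtain t where t: "0 \<le> t" "t \<le> l" "d q (\<gamma> t) \<le> (d q (\<gamma> 0) + d q (\<gamma> l) - l) / 2 + \<delta>"
      using point_near_geodesic[OF hyperbolic g(1) assms(2)] .
    have tm: "\<gamma> t \<in> M" using geodesic_path_mspace[OF g(1) t(1,2)] .
    have "geodesic_between X u (\<gamma> t) (\<gamma> ` {0..t})"
      using geodesic_between_sub[OF g(1), of 0 t] t g by auto
    moreover have "\<gamma> ` {0..t} \<subseteq> U"
      using 2 g t by auto
    ultimately have "(u, \<gamma> t) \<in> edge" using uv tm by (auto simp: edge_def)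
    then have "real (edist u q) \<le> 1 + (d (\<gamma> t) q + 1)"
      using edist_triangle_real[OF uv(1) tm assms(2)] edist_edge[of u "\<gamma> t"]
        edist_le[OF tm assms(2)] by linarith
    moreover have "d u v \<le> d u q + d v q"
      using mdist_triangle[OF uv(1) assms(2) uv(2)] mdist_commute[of X q v] by simp
    ultimately show ?thesis
      using t(3) g geodesic_path_length[OF g(1)] mdist_commute[of X q u] mdist_commute[of X q v]
        mdist_commute[of X q "\<gamma> t"] by (simp add: field_simps)
  qed
qed

text \<open>Each bisection of the chain costs one application of the four-point inequality to the Gromov
  product based at \<open>q\<close>, so the loss is logarithmic in the length of the chain.\<close>

lemma chain_passes_near:
  assumes "q \<in> M" "\<And>i. i \<le> n \<Longrightarrow> u (i + a) \<in> M" "1 \<le> n" "n \<le> 2 ^ k"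
  shows "\<exists>i<n. d (u (i + a)) q + d (u (Suc i + a)) q - d (u (i + a)) (u (Suc i + a))
    \<le> d (u a) q + d (u (n + a)) q - d (u a) (u (n + a)) + real k * \<delta>"
  using assms(2-4)
proof (induction k arbitrary: n a)
  case 0
  then have "n = 1" by simp
  then show ?case by simp
next
  case (Suc k)
  show ?case
  proof (cases "n = 1")
    case True
    then show ?thesis using delta_nonneg by (simp add: mult_nonneg_nonneg)
  next
    case False
    define m where "m = n div 2"
    have m: "1 \<le> m" "m < n" "m \<le> 2 ^ k" "n - m \<le> 2 ^ k" "1 \<le> n - m"
      using False Suc.prems by (auto simp: m_def)
    have um: "u a \<in> M" "u (m + a) \<in> M" "u (n + a) \<in> M"
      using Suc.prems(1)[of 0] Suc.prems(1)[of m] Suc.prems(1)[of n] m by auto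
    have 4: "d (u a) (u (n + a)) + d (u (m + a)) q
      \<le> max (d (u a) (u (m + a)) + d (u (n + a)) q) (d (u (m + a)) (u (n + a)) + d (u a) q) + \<delta>"
      using four_pointD[OF hyperbolic um(1,2,3) assms(1)] .
    show ?thesis
    proof (cases "d (u (m + a)) (u (n + a)) + d (u a) q \<le> d (u a) (u (m + a)) + d (u (n + a)) q")
      case True
      obtain i where "i < m" "d (u (i + a)) q + d (u (Suc i + a)) q - d (u (i + a)) (u (Suc i + a))
          \<le> d (u a) q + d (u (m + a)) q - d (u a) (u (m + a)) + real k * \<delta>"
        using Suc.IH[of m a] Suc.prems m by auto
      then show ?thesis using 4 True m by (intro exI[of _ i]) (auto simp: algebra_simps)
    next
      case False
      have "\<exists>i<n - m. d (u (i + (m + a))) q + d (u (Suc i + (m + a))) q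
           - d (u (i + (m + a))) (u (Suc i + (m + a)))
          \<le> d (u (m + a)) q + d (u (n - m + (m + a))) q - d (u (m + a)) (u (n - m + (m + a)))
             + real k * \<delta>"
      proof (rule Suc.IH)
        show "u (i + (m + a)) \<in> M" if "i \<le> n - m" for i
          using Suc.prems(1)[of "i + m"] that m by (auto simp: add.assoc)
      qed (use m in auto)
      then obtain i where "i < n - m" "d (u (i + (m + a))) q + d (u (Suc i + (m + a))) q
           - d (u (i + (m + a))) (u (Suc i + (m + a)))
          \<le> d (u (m + a)) q + d (u (n - m + (m + a))) q - d (u (m + a)) (u (n - m + (m + a)))
             + real k * \<delta>" by blast
      moreover have "n - m + (m + a) = n + a" using m by simp
      ultimately show ?thesis using 4 False
        by (intro exI[of _ "i + m"]) (auto simp: algebra_simps)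
    qed
  qed
qed


text \<open>This threshold is the bound that bisecting a chain of \<open>2\<^sup>k\<close> edges gives for the graph distance
  of some vertex to a point of the geodesic, multiplied by the constant that passes from an
  arbitrary point of the geodesic to the projection of the vertex.\<close>

definition far :: "nat \<Rightarrow> real" where
  "far k = (8 * \<delta> + 5) * (4 * \<delta> + real k * \<delta> + 2)"

lemma far_ge: "4 * \<delta> + 2 \<le> far k"
proof -
  have "1 * (4 * \<delta> + 2) \<le> (8 * \<delta> + 5) * (4 * \<delta> + real k * \<delta> + 2)"
    using delta_nonneg by (intro mult_mono) auto
  then show ?thesis by (simp add: far_def)
qed

end

section \<open>Projection to a geodesic\<close>

locale electrified_geodesic = electrification +
  fixes \<gamma> :: "real \<Rightarrow> 'a" and l :: real
  assumes path: "geodesic_path X \<gamma> l"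
begin

text \<open>The Gromov product of \<open>u\<close> and \<open>\<gamma> l\<close> based at \<open>\<gamma> 0\<close>: the parameter of the point of the geodesic
  that is coarsely closest to \<open>u\<close>.\<close>

definition pos :: "'a \<Rightarrow> real" where
  "pos u = (d (\<gamma> 0) u + l - d u (\<gamma> l)) / 2"

abbreviation proj :: "'a \<Rightarrow> 'a" where "proj u \<equiv> \<gamma> (pos u)"

definition gap :: "'a \<Rightarrow> nat" where "gap u = edist u (proj u)"

lemma length_nonneg: "0 \<le> l"
  using path by (simp add: geodesic_path_def)

lemma path_mspace: "0 \<le> t \<Longrightarrow> t \<le> l \<Longrightarrow> \<gamma> t \<in> M"
  using geodesic_path_mspace[OF path] .

lemma endpoints_mspace: "\<gamma> 0 \<in> M" "\<gamma> l \<in> M"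
  using path_mspace length_nonneg by auto

lemma pos_range:
  assumes "u \<in> M"
  shows "0 \<le> pos u" "pos u \<le> l"
  using mdist_triangle[OF assms endpoints_mspace] mdist_triangle[OF endpoints_mspace(1) assms endpoints_mspace(2)]
    mdist_triangle[OF endpoints_mspace assms] mdist_triangle[OF assms endpoints_mspace(2,1)]
    geodesic_path_length[OF path] mdist_commute[of X u "\<gamma> 0"] mdist_commute[of X "\<gamma> l"]
  by (auto simp: pos_def)

lemma proj_mspace: "u \<in> M \<Longrightarrow> proj u \<in> M"
  using pos_range path_mspace by blast

lemma pos_path: "0 \<le> t \<Longrightarrow> t \<le> l \<Longrightarrow> pos (\<gamma> t) = t"
  using geodesic_path_dist_left[OF path] geodesic_path_dist_right[OF path] by (simp add: pos_def)

lemma edist_path_le: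
  assumes "0 \<le> s" "s \<le> l" "0 \<le> t" "t \<le> l"
  shows "real (edist (\<gamma> s) (\<gamma> t)) \<le> \<bar>s - t\<bar> + 1"
  using edist_le[OF path_mspace path_mspace, of s t] path assms by (auto simp: geodesic_path_def)

text \<open>In a tree, points with distinct projections are joined by a segment that runs through the part
  of the geodesic between these projections.\<close>

lemma near_path_between_projections:
  assumes "u \<in> M" "v \<in> M" "\<delta> < pos v - pos u" "pos u \<le> t" "t \<le> pos v"
  shows "d u (\<gamma> t) + d v (\<gamma> t) - d u v \<le> 3 * \<delta>"
proof -
  have t: "0 \<le> t" "t \<le> l" using pos_range assms by fastforce+
  have "d u (\<gamma> l) + d (\<gamma> 0) v \<le> max (d u (\<gamma> 0) + d (\<gamma> l) v) (d (\<gamma> 0) (\<gamma> l) + d u v) + \<delta>"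
    using four_pointD[OF hyperbolic assms(1) endpoints_mspace assms(2)] .
  then have "d u (\<gamma> l) + d (\<gamma> 0) v \<le> l + d u v + \<delta>"
    using assms(3) delta_nonneg geodesic_path_length[OF path]
      mdist_commute[of X u "\<gamma> 0"] mdist_commute[of X v "\<gamma> l"]
    by (auto simp: pos_def max_def field_simps split: if_splits)
  moreover have "d u (\<gamma> t) \<le> t + d u (\<gamma> l) - l + \<delta>"
    using dist_geodesic_point_le[OF hyperbolic path t assms(1)] assms(4)
      mdist_commute[of X u "\<gamma> 0"] by (auto simp: pos_def)
  moreover have "d v (\<gamma> t) \<le> d (\<gamma> 0) v - t + \<delta>"
    using dist_geodesic_point_le[OF hyperbolic path t assms(2)] assms(5)
      mdist_commute[of X v "\<gamma> 0"] by (auto simp: pos_def)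
  ultimately show ?thesis by linarith
qed

text \<open>An edge whose endpoints have distant projections fellow-travels the geodesic between these
  projections, so its endpoints are close to all of that part.\<close>

lemma edge_near_path:
  assumes "(u, v) \<in> edge" "\<delta> < \<bar>pos u - pos v\<bar>" "min (pos u) (pos v) \<le> t" "t \<le> max (pos u) (pos v)"
  shows "real (edist u (\<gamma> t)) \<le> 4 * \<delta> + 2"
proof -
  have uv: "u \<in> M" "v \<in> M" using assms(1) edge_mspace by auto
  have t: "\<gamma> t \<in> M" using pos_range[OF uv(1)] pos_range[OF uv(2)] assms by (auto intro!: path_mspace)
  have "d u (\<gamma> t) + d v (\<gamma> t) - d u v \<le> 3 * \<delta>"
  proof (cases "pos u \<le> pos v")
    case True
    then show ?thesis using near_path_between_projections[OF uv, of t] assms by auto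
  next
    case False
    then show ?thesis
      using near_path_between_projections[OF uv(2,1), of t] assms mdist_commute[of X u v] by auto
  qed
  then show ?thesis using edist_edge_to_near_point[OF assms(1) t] by linarith
qed

lemma edge_pos_step:
  assumes "(u, v) \<in> edge"
  shows "\<bar>pos u - pos v\<bar> \<le> \<delta> \<or> (real (gap u) \<le> 4 * \<delta> + 2 \<and> real (gap v) \<le> 4 * \<delta> + 2)"
  using edge_near_path[OF assms, of "pos u"] edge_near_path[OF edge_sym[OF assms], of "pos v"]
  by (auto simp: gap_def abs_minus_commute)

text \<open>The projection is a coarsely Lipschitz retraction for the graph distance, although in \<open>X\<close> an
  edge may have projections arbitrarily far apart.\<close>

lemma edge_proj:
  assumes "(u, v) \<in> edge"
  shows "real (edist (proj u) (proj v)) \<le> 8 * \<delta> + 4"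
proof -
  have uv: "u \<in> M" "v \<in> M" using assms(1) edge_mspace by auto
  show ?thesis
  proof (cases "\<bar>pos u - pos v\<bar> \<le> \<delta>")
    case True
    then show ?thesis
      using edist_path_le[OF pos_range[OF uv(1)] pos_range[OF uv(2)]] delta_nonneg by linarith
  next
    case False
    then have "real (edist u (proj u)) \<le> 4 * \<delta> + 2" "real (edist u (proj v)) \<le> 4 * \<delta> + 2"
      using edge_near_path[OF assms] by auto
    then show ?thesis
      using edist_triangle_real[of "proj u" u "proj v"] edist_commute[of u "proj u"] uv proj_mspace
      by fastforce
  qed
qed

lemma proj_lipschitz:
  assumes "u \<in> M" "v \<in> M"
  shows "real (edist (proj u) (proj v)) \<le> (8 * \<delta> + 4) * real (edist u v)"
proof -
  have "(u, v) \<in> edge ^^ n \<Longrightarrow> v \<in> M \<and> real (edist (proj u) (proj v)) \<le> (8 * \<delta> + 4) * real n" for n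
  proof (induction n arbitrary: v)
    case (Suc n)
    then obtain w where w: "(u, w) \<in> edge ^^ n" "(w, v) \<in> edge" by auto
    have "w \<in> M" "v \<in> M" using w edge_mspace by auto
    then show ?case
      using Suc.IH[OF w(1)] edge_proj[OF w(2)] edist_triangle_real[of "proj u" "proj w" "proj v"]
        proj_mspace assms(1) by (fastforce simp: algebra_simps)
  qed (use assms in auto)
  then show ?thesis using edist_path[OF assms] by blast
qed

lemma gap_le:
  assumes "u \<in> M" "0 \<le> t" "t \<le> l"
  shows "real (gap u) \<le> (8 * \<delta> + 5) * real (edist u (\<gamma> t))"
proof -
  have "real (edist u (proj u)) \<le> real (edist u (\<gamma> t)) + real (edist (proj u) (\<gamma> t))"
    using edist_triangle_real[of u "\<gamma> t" "proj u"] edist_commute[of "\<gamma> t" "proj u"]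
      assms path_mspace proj_mspace by simp
  also have "\<dots> \<le> real (edist u (\<gamma> t)) + (8 * \<delta> + 4) * real (edist u (\<gamma> t))"
    using proj_lipschitz[OF assms(1) path_mspace[OF assms(2,3)]] pos_path[OF assms(2,3)] by simp
  finally show ?thesis by (simp add: gap_def algebra_simps)
qed

text \<open>If the projection moved, the geodesic between the ends of the chain would come close to the
  projections, hence by bisection so would one of the edges.\<close>

lemma far_chain_contracts:
  assumes "\<And>i. i < n \<Longrightarrow> (u (i + a), u (Suc i + a)) \<in> edge" "1 \<le> n" "n \<le> 2 ^ k"
    "\<And>i. i \<le> n \<Longrightarrow> far k < real (gap (u (i + a)))"
  shows "\<bar>pos (u a) - pos (u (n + a))\<bar> \<le> \<delta>"
proof (rule ccontr)
  assume far: "\<not> ?thesis"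
  have M: "u (i + a) \<in> M" if "i \<le> n" for i
    using assms(1)[of i] assms(1)[of "i - 1"] assms(2) that edge_mspace
    by (cases "i = n") (auto simp: Suc_le_eq)
  have ends: "u a \<in> M" "u (n + a) \<in> M" using M[of 0] M[of n] by auto
  define t where "t = pos (u a)"
  have t: "0 \<le> t" "t \<le> l" using pos_range[OF ends(1)] by (auto simp: t_def)
  have "d (u a) (\<gamma> t) + d (u (n + a)) (\<gamma> t) - d (u a) (u (n + a)) \<le> 3 * \<delta>"
  proof (cases "pos (u a) \<le> pos (u (n + a))")
    case True
    then show ?thesis using near_path_between_projections[OF ends, of t] far by (auto simp: t_def)
  next
    case False
    then show ?thesis
      using near_path_between_projections[OF ends(2,1), of t] far mdist_commute[of X "u a"]
      by (auto simp: t_def)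
  qed
  then obtain i where i: "i < n"
    "d (u (i + a)) (\<gamma> t) + d (u (Suc i + a)) (\<gamma> t) - d (u (i + a)) (u (Suc i + a))
       \<le> 3 * \<delta> + real k * \<delta>"
    using chain_passes_near[of "\<gamma> t" n u a k] path_mspace[OF t] M assms(2,3) by force
  have "real (edist (u (i + a)) (\<gamma> t)) \<le> 4 * \<delta> + real k * \<delta> + 2"
    using edist_edge_to_near_point[OF assms(1)[OF i(1)] path_mspace[OF t]] i(2) by linarith
  then have "real (gap (u (i + a))) \<le> far k"
    unfolding far_def using gap_le[OF M[of i] t] i(1) delta_nonneg
    by (smt (verit) mult_left_mono less_imp_le_nat)
  then show False using assms(4)[of i] i(1) by simp
qed

text \<open>Cutting the chain into stretches of \<open>2 ^ k\<close> edges makes the speed of the projection as small as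
  desired; a bound per single edge would not be enough to beat a geodesic chain.\<close>

lemma far_chain_drift:
  assumes "\<And>i. i < n \<Longrightarrow> (u (i + a), u (Suc i + a)) \<in> edge"
    "\<And>i. i \<le> n \<Longrightarrow> far k < real (gap (u (i + a)))"
  shows "\<bar>pos (u a) - pos (u (n + a))\<bar> \<le> \<delta> * (real n / 2 ^ k + 1)"
  using assms
proof (induction n arbitrary: a rule: less_induct)
  case (less n)
  consider "n = 0" | "1 \<le> n" "n \<le> 2 ^ k" | "2 ^ k < n" by linarith
  then show ?case
  proof cases
    case 1
    then show ?thesis using delta_nonneg by simp
  next
    case 2
    then have "\<bar>pos (u a) - pos (u (n + a))\<bar> \<le> \<delta> * 1"
      using far_chain_contracts[of n u a k] less.prems by simp
    also have "\<dots> \<le> \<delta> * (real n / 2 ^ k + 1)" using delta_nonneg by (intro mult_left_mono) auto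
    finally show ?thesis .
  next
    case 3
    define m where "m = n - 2 ^ k"
    have nm: "n = m + 2 ^ k" "m < n" using 3 by (auto simp: m_def)
    have "\<bar>pos (u a) - pos (u (2 ^ k + a))\<bar> \<le> \<delta>"
      using less.prems nm by (intro far_chain_contracts[of "2 ^ k" u a k]) auto
    moreover have "\<bar>pos (u (2 ^ k + a)) - pos (u (m + (2 ^ k + a)))\<bar> \<le> \<delta> * (real m / 2 ^ k + 1)"
    proof (rule less.IH[OF nm(2)])
      show "(u (i + (2 ^ k + a)), u (Suc i + (2 ^ k + a))) \<in> edge" if "i < m" for i
        using less.prems(1)[of "i + 2 ^ k"] that nm by (simp add: add.assoc)
      show "far k < real (gap (u (i + (2 ^ k + a))))" if "i \<le> m" for i
        using less.prems(2)[of "i + 2 ^ k"] that nm by (simp add: add.assoc)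
    qed
    moreover have "m + (2 ^ k + a) = n + a" using nm by simp
    moreover have "\<delta> * (real n / 2 ^ k + 1) = \<delta> * (real m / 2 ^ k + 1) + \<delta>"
      using nm by (simp add: field_simps)
    ultimately show ?thesis by (smt (verit))
  qed
qed

text \<open>By the choice of \<open>k\<close> the projection moves at speed at most one half along the excursion.
  Returning along the geodesic is thus about twice as fast as the excursion itself, which is
  impossible for a long excursion on a shortest chain.\<close>

lemma excursion_length:
  assumes "2 * \<delta> \<le> 2 ^ k" "i < j"
    and edges: "\<And>r. i \<le> r \<Longrightarrow> r < j \<Longrightarrow> (u r, u (Suc r)) \<in> edge"
    and away: "\<And>r. i < r \<Longrightarrow> r < j \<Longrightarrow> far k < real (gap (u r))"
  shows "r \<in> {i<..<j} \<Longrightarrow> \<bar>pos (u i) - pos (u r)\<bar> \<le> 2 * \<delta> + real (j - i) / 2"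
    and "\<lbrakk>Suc i < j; real (gap (u i)) \<le> far k; real (gap (u j)) \<le> far k;
      edist (u i) (u j) = j - i\<rbrakk> \<Longrightarrow> real (j - i) \<le> 4 * far k + 6 * \<delta> + 2"
proof -
  have step: "\<bar>pos (u r) - pos (u (Suc r))\<bar> \<le> \<delta>"
    if "i \<le> r" "r < j" "i < r \<or> Suc r < j" for r
    using edge_pos_step[OF edges[OF that(1,2)]] away[of r] away[of "Suc r"] that far_ge[of k]
    by force
  have *: "\<bar>pos (u i) - pos (u r)\<bar> \<le> 2 * \<delta> + real (j - i) / 2" if "i < r" "r < j" for r
  proof -
    have "\<bar>pos (u (Suc i)) - pos (u (r - Suc i + Suc i))\<bar> \<le> \<delta> * (real (r - Suc i) / 2 ^ k + 1)"
    proof (rule far_chain_drift)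
      show "(u (ia + Suc i), u (Suc ia + Suc i)) \<in> edge" if "ia < r - Suc i" for ia
        using edges[of "ia + Suc i"] that \<open>r < j\<close> by simp
      show "far k < real (gap (u (ia + Suc i)))" if "ia \<le> r - Suc i" for ia
        using away[of "ia + Suc i"] that \<open>r < j\<close> \<open>i < r\<close> by simp
    qed
    also have "\<dots> = (\<delta> / 2 ^ k) * real (r - Suc i) + \<delta>" by (simp add: field_simps)
    also have "\<dots> \<le> 1 / 2 * real (j - i) + \<delta>"
      using assms(1) that delta_nonneg by (intro add_right_mono mult_mono) (auto simp: field_simps)
    finally show ?thesis using step[of i] that by force
  qed
  then show "r \<in> {i<..<j} \<Longrightarrow> \<bar>pos (u i) - pos (u r)\<bar> \<le> 2 * \<delta> + real (j - i) / 2" by simp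
  assume ij: "Suc i < j" and gap: "real (gap (u i)) \<le> far k" "real (gap (u j)) \<le> far k"
    and geo: "edist (u i) (u j) = j - i"
  have M: "u i \<in> M" "u j \<in> M"
    using edges[of i] edges[of "j - 1"] edge_mspace[of "u i"] edge_mspace[of "u (j - 1)"] ij by simp_all
  have "\<bar>pos (u i) - pos (u j)\<bar> \<le> 3 * \<delta> + real (j - i) / 2"
    using *[of "j - 1"] step[of "j - 1"] ij by force
  then have "real (edist (proj (u i)) (proj (u j))) \<le> 3 * \<delta> + real (j - i) / 2 + 1"
    using edist_path_le[OF pos_range[OF M(1)] pos_range[OF M(2)]] by linarith
  moreover have "real (edist (u i) (u j))
      \<le> real (gap (u i)) + (real (edist (proj (u i)) (proj (u j))) + real (gap (u j)))"
    using edist_triangle_real[of "u i" "proj (u i)" "u j"]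
      edist_triangle_real[of "proj (u i)" "proj (u j)" "u j"]
      edist_commute[of "u j" "proj (u j)"] M proj_mspace
    by (fastforce simp: gap_def)
  ultimately show "real (j - i) \<le> 4 * far k + 6 * \<delta> + 2"
    using gap geo by (simp add: field_simps)
qed

text \<open>Where the projection of the chain crosses \<open>t\<close>, either a long edge runs along the geodesic, or
  the chain is close to its projection there, or it is on an excursion; an excursion is short, so
  its starting point will do.\<close>

lemma chain_near_path:
  assumes k: "2 * \<delta> \<le> 2 ^ k" and t: "0 \<le> t" "t \<le> l"
    and u: "u 0 = \<gamma> 0" "u n = \<gamma> l" "0 < n"
      "\<And>i. i < n \<Longrightarrow> (u i, u (Suc i)) \<in> edge"
      "\<And>i j. i \<le> j \<Longrightarrow> j \<le> n \<Longrightarrow> edist (u i) (u j) = j - i"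
  shows "\<exists>i\<le>n. real (edist (u i) (\<gamma> t)) \<le> 3 * far k + 6 * \<delta> + 2"
proof -
  have far: "0 \<le> far k" "4 * \<delta> + 2 \<le> far k" using far_ge[of k] delta_nonneg by auto
  have ends: "pos (u 0) = 0" "pos (u n) = l"
    using u(1,2) pos_path length_nonneg by auto
  have gap_ends: "gap (u 0) = 0" "gap (u n) = 0"
    using ends u by (auto simp: gap_def)
  obtain c where c: "c < n" "pos (u c) \<le> t" "t \<le> pos (u (Suc c))"
    using discrete_intermediate_value[of "\<lambda>i. pos (u i)" t n] ends t u(3) by auto
  have close: "real (edist (u i) (\<gamma> t)) \<le> real (gap (u i)) + \<bar>pos (u i) - t\<bar> + 1" if "i < n" for i
  proof -
    have i: "u i \<in> M" using u(4)[OF that] edge_mspace by blast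
    show ?thesis
      using edist_triangle_real[OF i proj_mspace[OF i] path_mspace[OF t]]
        edist_path_le[OF pos_range[OF i] t] by (simp add: gap_def)
  qed
  show ?thesis
  proof (cases "\<bar>pos (u c) - pos (u (Suc c))\<bar> \<le> \<delta>")
    case False
    then have "real (edist (u c) (\<gamma> t)) \<le> 4 * \<delta> + 2"
      using edge_near_path[OF u(4)[OF c(1)], of t] c by auto
    then show ?thesis using far delta_nonneg c(1) by (intro exI[of _ c]) auto
  next
    case step: True
    show ?thesis
    proof (cases "real (gap (u c)) \<le> far k")
      case True
      then have "real (edist (u c) (\<gamma> t)) \<le> far k + \<delta> + 1"
        using close[OF c(1)] step c by linarith
      then show ?thesis using far delta_nonneg c(1) by (intro exI[of _ c]) auto
    next
      case False
      \<comment> \<open>the excursion containing the crossing runs from \<open>i\<close> to \<open>j\<close>\<close>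
      define i where "i = Max {r. r \<le> c \<and> real (gap (u r)) \<le> far k}"
      define j where "j = Min {r. c \<le> r \<and> r \<le> n \<and> real (gap (u r)) \<le> far k}"
      have imem: "i \<in> {r. r \<le> c \<and> real (gap (u r)) \<le> far k}"
        unfolding i_def using gap_ends far by (intro Max_in) (auto intro!: exI[of _ 0])
      have imax: "r \<le> i" if "r \<le> c" "real (gap (u r)) \<le> far k" for r
        unfolding i_def using that by (intro Max_ge) auto
      have jmem: "j \<in> {r. c \<le> r \<and> r \<le> n \<and> real (gap (u r)) \<le> far k}"
        unfolding j_def using gap_ends far c(1) by (intro Min_in) (auto intro!: exI[of _ n])
      have jmin: "j \<le> r" if "c \<le> r" "r \<le> n" "real (gap (u r)) \<le> far k" for r
        unfolding j_def using that by (intro Min_le) auto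
      have "i \<noteq> c" "j \<noteq> c" using imem jmem False by auto
      then have ij: "i < c" "c < j" "j \<le> n" "real (gap (u i)) \<le> far k" "real (gap (u j)) \<le> far k"
        using imem jmem by auto
      have away: "far k < real (gap (u r))" if "i < r" "r < j" for r
        using imax[of r] jmin[of r] that ij by (cases "r \<le> c") force+
      have edges: "(u r, u (Suc r)) \<in> edge" if "i \<le> r" "r < j" for r
        using u(4) ij that by simp
      have "real (j - i) \<le> 4 * far k + 6 * \<delta> + 2"
        using excursion_length(2)[of k i j u] k edges away u(5)[of i j] ij by auto
      moreover have "\<bar>pos (u i) - pos (u c)\<bar> \<le> 2 * \<delta> + real (j - i) / 2"
        using excursion_length(1)[of k i j u c] k edges away ij by auto
      ultimately have "\<bar>pos (u i) - t\<bar> \<le> 6 * \<delta> + 2 * far k + 1"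
        using step c by linarith
      then have "real (edist (u i) (\<gamma> t)) \<le> 3 * far k + 6 * \<delta> + 2"
        using close[of i] ij by linarith
      then show ?thesis using ij by (intro exI[of _ i]) auto
    qed
  qed
qed

lemma edist_additive_on_path:
  assumes k: "2 * \<delta> \<le> 2 ^ k" and t: "0 \<le> t" "t \<le> l"
  shows "real (edist (\<gamma> 0) (\<gamma> t)) + real (edist (\<gamma> t) (\<gamma> l))
    \<le> real (edist (\<gamma> 0) (\<gamma> l)) + 2 * (3 * far k + 6 * \<delta> + 2)"
proof -
  define n where "n = edist (\<gamma> 0) (\<gamma> l)"
  obtain u where u: "u 0 = \<gamma> 0" "u n = \<gamma> l"
    "\<And>i. i < n \<Longrightarrow> (u i, u (Suc i)) \<in> edge" "\<And>i. i \<le> n \<Longrightarrow> u i \<in> M"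
    "\<And>i j. i \<le> j \<Longrightarrow> j \<le> n \<Longrightarrow> edist (u i) (u j) = j - i"
    using edist_geodesic_chain[OF endpoints_mspace] unfolding n_def by blast
  show ?thesis
  proof (cases "n = 0")
    case True
    then have "\<gamma> 0 = \<gamma> l" using u by simp
    then have "l = 0" using geodesic_path_length[OF path] endpoints_mspace
      mdist_zero[of "\<gamma> l" X "\<gamma> l"] by simp
    then have "t = 0" using t by simp
    then show ?thesis using \<open>l = 0\<close> far_ge[of k] delta_nonneg by simp
  next
    case False
    then obtain i where i: "i \<le> n" "real (edist (u i) (\<gamma> t)) \<le> 3 * far k + 6 * \<delta> + 2"
      using chain_near_path[OF k t u(1,2) _ u(3,5)] by auto
    have m: "u i \<in> M" "\<gamma> t \<in> M" using u(4) i path_mspace t by auto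
    have "edist (\<gamma> 0) (u i) + edist (u i) (\<gamma> l) = n"
      using u(5)[of 0 i] u(5)[of i n] u(1,2) i by simp
    then have "real (edist (\<gamma> 0) (u i)) + real (edist (u i) (\<gamma> l)) = real n" by linarith
    then show ?thesis
      using edist_triangle_real[OF endpoints_mspace(1) m] edist_triangle_real[OF m(2,1) endpoints_mspace(2)]
        i(2) unfolding n_def edist_commute[OF m(2,1)] by (simp add: algebra_simps)
  qed
qed

end

context electrification
begin

text \<open>The constant is uniform over all geodesics, and a point off the geodesic is replaced by a nearby
  point on it.\<close>

lemma edist_additive:
  obtains C where "0 \<le> C"
    "\<And>x y q. \<lbrakk>x \<in> M; y \<in> M; q \<in> M\<rbrakk> \<Longrightarrow>
      real (edist x q) + real (edist q y) \<le> real (edist x y) + (d q x + d q y - d x y) + C"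
proof -
  obtain k where "2 * \<delta> < 2 ^ k" using real_arch_pow[of 2 "2 * \<delta>"] by auto
  then have k: "2 * \<delta> \<le> 2 ^ k" by simp
  define C where "C = 2 * (3 * far k + 6 * \<delta> + 2) + 2 * \<delta> + 2"
  have "real (edist x q) + real (edist q y) \<le> real (edist x y) + (d q x + d q y - d x y) + C"
    if xyq: "x \<in> M" "y \<in> M" "q \<in> M" for x y q
  proof -
    obtain \<gamma> where g: "geodesic_path X \<gamma> (d x y)" "\<gamma> 0 = x" "\<gamma> (d x y) = y"
      using geodesic_exists xyq by blast
    interpret electrified_geodesic X \<delta> U \<gamma> "d x y"
      by unfold_locales (rule g(1))
    obtain t where t: "0 \<le> t" "t \<le> d x y" "d q (\<gamma> t) \<le> (d q x + d q y - d x y) / 2 + \<delta>"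
      using point_near_geodesic[OF hyperbolic path xyq(3)] g by metis
    have m: "\<gamma> t \<in> M" using path_mspace t by blast
    show ?thesis
      using edist_additive_on_path[OF k t(1,2)] edist_triangle_real[OF xyq(1) m xyq(3)]
        edist_triangle_real[OF xyq(3) m xyq(2)] edist_le[OF xyq(3) m] edist_commute[OF m xyq(3)] t(3) g
      by (simp add: C_def field_simps)
  qed
  moreover have "0 \<le> C" using far_ge[of k] delta_nonneg by (simp add: C_def)
  ultimately show thesis using that by blast
qed

text \<open>In the tree spanned by the four points, the branch point \<open>q\<close> of \<open>x\<close> and \<open>y\<close> as seen from
  \<open>w\<close> lies on the way from \<open>w\<close> to \<open>z\<close> as well; additivity of the graph distance at \<open>q\<close> on the
  sides \<open>wx\<close>, \<open>wz\<close> and \<open>xy\<close> gives the inequality.\<close>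

lemma edist_four_point:
  obtains c where "four_point M (\<lambda>x y. real (edist x y)) c"
proof -
  obtain C where C: "0 \<le> C" "\<And>x y q. \<lbrakk>x \<in> M; y \<in> M; q \<in> M\<rbrakk> \<Longrightarrow>
      real (edist x q) + real (edist q y) \<le> real (edist x y) + (d q x + d q y - d x y) + C"
    using edist_additive by blast
  have half: "real (edist x z) + real (edist y w)
      \<le> real (edist x y) + real (edist z w) + 3 * (\<delta> + C)"
    if m: "x \<in> M" "y \<in> M" "z \<in> M" "w \<in> M" and le: "d x w - d x y \<le> d z w - d y z" for x y z w
  proof -
    obtain \<gamma> where g: "geodesic_path X \<gamma> (d w y)" "\<gamma> 0 = w" "\<gamma> (d w y) = y"
      using geodesic_exists m by blast
    define t where "t = (d x w + d y w - d x y) / 2"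
    have "d x y \<le> d x w + d y w" "d x w \<le> d x y + d y w"
      using mdist_triangle[of x X w y] mdist_triangle[of x X y w] m mdist_commute[of X w y] by auto
    moreover have "d y w \<le> d x w + d x y"
      using mdist_triangle[of y X x w] m mdist_commute[of X y x] by auto
    ultimately have t: "0 \<le> t" "t \<le> d w y"
      using mdist_commute[of X w y] by (auto simp: t_def)
    define q where "q = \<gamma> t"
    have q: "q \<in> M" using geodesic_path_mspace[OF g(1) t] by (simp add: q_def)
    have "d w q = t" "d q y = d w y - t"
      using geodesic_path_dist_left[OF g(1) t] geodesic_path_dist_right[OF g(1) t] g
      by (auto simp: q_def)
    moreover have "d x q \<le> d x w - t + \<delta>" "d z q \<le> d z w - t + \<delta>"
      using dist_geodesic_point_le[OF hyperbolic g(1) t m(1)]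
        dist_geodesic_point_le[OF hyperbolic g(1) t m(3)] g le
        mdist_commute[of X w y] mdist_commute[of X y z]
      by (auto simp: q_def t_def max_def field_simps split: if_splits)
    ultimately have "d q w + d q x - d w x \<le> \<delta>" "d q w + d q z - d w z \<le> \<delta>"
        "d q x + d q y - d x y \<le> \<delta>"
      unfolding mdist_commute[of X q w] mdist_commute[of X q x] mdist_commute[of X w x]
        mdist_commute[of X q z] mdist_commute[of X w z] mdist_commute[of X w y]
      by (simp_all add: t_def field_simps)
    then show ?thesis
      using C(2)[of w x q] C(2)[of w z q] C(2)[of x y q] m q
        edist_triangle_real[of x q z] edist_triangle_real[of y q w] edist_triangle_real[of x q w]
        edist_commute[of x q] edist_commute[of y q] edist_commute[of w q]
        edist_commute[of w x] edist_commute[of w z]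
      by simp
  qed
  have "four_point M (\<lambda>x y. real (edist x y)) (3 * (\<delta> + C))"
    unfolding four_point_def
  proof (intro ballI)
    fix x y z w assume m: "x \<in> M" "y \<in> M" "z \<in> M" "w \<in> M"
    show "real (edist x z) + real (edist y w)
      \<le> max (real (edist x y) + real (edist z w)) (real (edist y z) + real (edist x w)) + 3 * (\<delta> + C)"
    proof (cases "d x w - d x y \<le> d z w - d y z")
      case True
      then show ?thesis using half[OF m] by simp
    next
      case False
      then show ?thesis
        using half[of z y x w] m mdist_commute[of X x y] mdist_commute[of X y z]
          edist_commute[of z x] edist_commute[of z y]
        by simp
    qed
  qed
  then show thesis using that by blast
qed

lemma edist_coarsely_geodesic:
  assumes "x \<in> M" "y \<in> M" "0 \<le> t" "t \<le> real (edist x y)"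
  shows "\<exists>z\<in>M. real (edist x z) \<le> t \<and> real (edist z y) \<le> real (edist x y) - t + 1"
proof -
  define n where "n = nat \<lfloor>t\<rfloor>"
  have n: "n \<le> edist x y" "real n \<le> t" "t \<le> real n + 1"
    using assms(3,4) unfolding n_def by linarith+
  obtain u where u: "u 0 = x" "u (edist x y) = y"
    "\<And>i. i < edist x y \<Longrightarrow> (u i, u (Suc i)) \<in> edge"
    "\<And>i. i \<le> edist x y \<Longrightarrow> u i \<in> M"
    "\<And>i j. i \<le> j \<Longrightarrow> j \<le> edist x y \<Longrightarrow> edist (u i) (u j) = j - i"
    by (rule edist_geodesic_chain[OF assms(1,2)]) blast
  have "edist x (u n) = n" "edist (u n) y = edist x y - n"
    using u(5)[of 0 n] u(5)[of n "edist x y"] u(1,2) n(1) by auto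
  then show ?thesis using n u(4)[of n] by (intro bexI[of _ "u n"]) auto
qed

lemma edist_intermediate_value:
  assumes g: "geodesic_path X \<gamma> l" and "0 \<le> r" "r \<le> real (edist (\<gamma> 0) (\<gamma> l))"
  shows "\<exists>t. 0 \<le> t \<and> t \<le> l \<and> \<bar>real (edist (\<gamma> 0) (\<gamma> t)) - r\<bar> \<le> 2"
proof -
  have l: "0 \<le> l" using g by (simp add: geodesic_path_def)
  define s where "s k = min (real k) l" for k :: nat
  define f where "f k = real (edist (\<gamma> 0) (\<gamma> (s k)))" for k :: nat
  have s: "0 \<le> s k" "s k \<le> l" for k using l by (auto simp: s_def)
  have m: "\<gamma> (s k) \<in> M" "\<gamma> 0 \<in> M" for k
    using geodesic_path_mspace[OF g s] geodesic_path_mspace[OF g, of 0] l by auto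
  have "s 0 = 0" "s (Suc (nat \<lceil>l\<rceil>)) = l" unfolding s_def using l by linarith+
  then obtain k where k: "f k \<le> r" "r \<le> f (Suc k)"
    using discrete_intermediate_value[of f r "Suc (nat \<lceil>l\<rceil>)"] assms by (auto simp: f_def)
  have "d (\<gamma> (s k)) (\<gamma> (s (Suc k))) = \<bar>s k - s (Suc k)\<bar>"
    using g s by (auto simp: geodesic_path_def)
  also have "\<dots> \<le> 1" by (auto simp: s_def)
  finally have "f (Suc k) \<le> f k + 2"
    unfolding f_def
    using edist_triangle_real[OF m(2) m(1)[of k] m(1)[of "Suc k"]]
      edist_le[OF m(1)[of k] m(1)[of "Suc k"]] by linarith
  then show ?thesis using k s[of k] by (intro exI[of _ "s k"]) (auto simp: f_def)
qed

text \<open>An almost shortest geodesic to \<open>A\<close> approaches all of \<open>A\<close> at almost unit speed, so it remains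
  further than \<open>R\<close> from \<open>A\<close> except for a final piece of length \<open>R + 2\<close>; one edge covers the rest.\<close>

lemma edist_to_avoided_set:
  assumes "A \<noteq> {}" "A \<subseteq> M" "x \<in> M" "0 \<le> R"
    and U: "\<And>z. z \<in> M \<Longrightarrow> (\<And>a. a \<in> A \<Longrightarrow> R < d z a) \<Longrightarrow> z \<in> U"
  shows "\<exists>a\<in>A. real (edist x a) \<le> R + 4"
proof -
  define r where "r = (INF a\<in>A. d x a)"
  have bdd: "bdd_below (d x ` A)" by (auto intro!: bdd_belowI2[of _ 0])
  have lower: "r \<le> d x a" if "a \<in> A" for a
    unfolding r_def using bdd that by (rule cINF_lower)
  have "\<exists>a\<in>A. d x a < r + 1"
    using assms(1) bdd cINF_less_iff[of A "d x" "r + 1"] by (simp add: r_def)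
  then obtain a where a: "a \<in> A" "d x a < r + 1" ..
  have aM: "a \<in> M" using a assms by auto
  show ?thesis
  proof (cases "d x a \<le> R + 2")
    case True
    then show ?thesis using edist_le[OF assms(3) aM] a by (intro bexI[of _ a]) auto
  next
    case False
    obtain \<gamma> where g: "geodesic_path X \<gamma> (d x a)" "\<gamma> 0 = x" "\<gamma> (d x a) = a"
      using geodesic_exists assms(3) aM by blast
    define t where "t = d x a - R - 2"
    have t: "0 \<le> t" "t \<le> d x a" using False assms(4) by (auto simp: t_def)
    have tM: "\<gamma> t \<in> M" using geodesic_path_mspace[OF g(1) t] .
    have "\<gamma> s \<in> U" if s: "0 \<le> s" "s \<le> t" for s
    proof -
      have sl: "s \<le> d x a" using s t by simp
      have sM: "\<gamma> s \<in> M" using geodesic_path_mspace[OF g(1) s(1) sl] .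
      show ?thesis
      proof (rule U[OF sM])
        fix b assume b: "b \<in> A"
        have "d x b \<le> d x (\<gamma> s) + d (\<gamma> s) b"
          using mdist_triangle[OF assms(3) sM] b assms(2) by blast
        then show "R < d (\<gamma> s) b"
          using geodesic_path_dist_left[OF g(1) s(1) sl] g(2) lower[OF b] a(2) s
          by (simp add: t_def)
      qed
    qed
    then have "\<gamma> ` {0..t} \<subseteq> U" by auto
    then have "(x, \<gamma> t) \<in> edge"
      using geodesic_between_sub[OF g(1), of 0 t] t tM assms(3) g(2) by (auto simp: edge_def)
    then have "real (edist x a) \<le> R + 4"
      using edist_edge[of x "\<gamma> t"] edist_triangle_real[OF assms(3) tM aM] edist_le[OF tM aM]
        geodesic_path_dist_right[OF g(1) t] g(3) by (simp add: t_def)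
    then show ?thesis using a by blast
  qed
qed

lemma edist_isometry_le:
  assumes h: "\<And>x. x \<in> M \<Longrightarrow> h x \<in> M" "\<And>x y. \<lbrakk>x \<in> M; y \<in> M\<rbrakk> \<Longrightarrow> d (h x) (h y) = d x y"
    "\<And>x. x \<in> U \<Longrightarrow> x \<in> M \<Longrightarrow> h x \<in> U"
    and "u \<in> M" "v \<in> M"
  shows "edist (h u) (h v) \<le> edist u v"
proof -
  have edge: "(h x, h y) \<in> edge" if xy: "(x, y) \<in> edge" for x y
  proof (cases "d x y \<le> 1")
    case True
    then show ?thesis using xy h by (auto simp: edge_def)
  next
    case False
    then obtain \<gamma> l where g: "geodesic_path X \<gamma> l" "\<gamma> 0 = x" "\<gamma> l = y" "\<gamma> ` {0..l} \<subseteq> U"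
      using xy by (auto simp: edge_def geodesic_between_iff_path)
    have "geodesic_path X (h \<circ> \<gamma>) l" using g(1) h(1,2) by (simp add: geodesic_path_def image_subset_iff)
    moreover have "(h \<circ> \<gamma>) ` {0..l} \<subseteq> U"
      using g(4) geodesic_path_mspace[OF g(1)] h(3) by fastforce
    moreover have "(h \<circ> \<gamma>) 0 = h x" "(h \<circ> \<gamma>) l = h y" using g by auto
    ultimately have "\<exists>S. geodesic_between X (h x) (h y) S \<and> S \<subseteq> U"
      unfolding geodesic_between_iff_path by blast
    then show ?thesis using xy h by (auto simp: edge_def)
  qed
  have "(x, y) \<in> edge ^^ n \<Longrightarrow> (h x, h y) \<in> edge ^^ n" for x y n
  proof (induction n arbitrary: y)
    case (Suc n)
    then show ?case using edge by fastforce
  qed simp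
  then show ?thesis using edist_path[OF assms(4,5)] by (blast intro: edist_le_power)
qed

end

text \<open>An edge that moves the projection by more than \<open>\<delta> + 1\<close> is too long for a short edge, hence runs
  through \<open>U\<close>, and at the same time it passes close to the geodesic.\<close>

lemma (in electrified_geodesic) electrification_undistorted:
  assumes "\<And>s t. \<lbrakk>s \<in> U; s \<in> M; 0 \<le> t; t \<le> l\<rbrakk> \<Longrightarrow> 3 * \<delta> < d (\<gamma> t) s"
  shows "l \<le> (\<delta> + 1) * real (edist (\<gamma> 0) (\<gamma> l))"
proof -
  have step: "\<bar>pos u - pos v\<bar> \<le> \<delta> + 1" if uv: "(u, v) \<in> edge" for u v
  proof (rule ccontr)
    assume far: "\<not> ?thesis"
    have m: "u \<in> M" "v \<in> M" using uv edge_mspace by auto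
    have "\<bar>pos u - pos v\<bar> \<le> d u v"
      using mdist_triangle[OF endpoints_mspace(1) m] mdist_triangle[OF endpoints_mspace(1) m(2,1)]
        mdist_triangle[OF m endpoints_mspace(2)] mdist_triangle[OF m(2,1) endpoints_mspace(2)]
        mdist_commute[of X u v] by (auto simp: pos_def field_simps abs_le_iff)
    then obtain \<sigma> m where s: "geodesic_path X \<sigma> m" "\<sigma> 0 = u" "\<sigma> m = v" "\<sigma> ` {0..m} \<subseteq> U"
      using uv far delta_nonneg by (force simp: edge_def geodesic_between_iff_path)
    define t where "t = pos u"
    have t: "0 \<le> t" "t \<le> l" using pos_range[OF m(1)] by (auto simp: t_def)
    have "d u (\<gamma> t) + d v (\<gamma> t) - d u v \<le> 3 * \<delta>"
    proof (cases "pos u \<le> pos v")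
      case True
      then show ?thesis using near_path_between_projections[OF m, of t] far by (auto simp: t_def)
    next
      case False
      then show ?thesis
        using near_path_between_projections[OF m(2,1), of t] far mdist_commute[of X u v]
        by (auto simp: t_def)
    qed
    moreover obtain r where r: "0 \<le> r" "r \<le> m"
      "d (\<gamma> t) (\<sigma> r) \<le> (d (\<gamma> t) (\<sigma> 0) + d (\<gamma> t) (\<sigma> m) - m) / 2 + \<delta>"
      using point_near_geodesic[OF hyperbolic s(1) path_mspace[OF t]] .
    ultimately have "d (\<gamma> t) (\<sigma> r) \<le> 3 * \<delta>"
      using geodesic_path_length[OF s(1)] s delta_nonneg
        mdist_commute[of X "\<gamma> t" u] mdist_commute[of X "\<gamma> t" v] by (simp add: field_simps)
    moreover have "\<sigma> r \<in> U" "\<sigma> r \<in> M" using s(4) r geodesic_path_mspace[OF s(1)] by auto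
    ultimately show False using assms[OF _ _ t] by fastforce
  qed
  have "(\<gamma> 0, v) \<in> edge ^^ n \<Longrightarrow> pos v \<le> (\<delta> + 1) * real n" for v n
  proof (induction n arbitrary: v)
    case 0
    then show ?case using pos_path[of 0] length_nonneg by simp
  next
    case (Suc n)
    then obtain w where "(\<gamma> 0, w) \<in> edge ^^ n" "(w, v) \<in> edge" by auto
    then show ?case using Suc.IH[of w] step[of w v] by (simp add: algebra_simps)
  qed
  then show ?thesis
    using edist_path[OF endpoints_mspace] pos_path[of l] length_nonneg by force
qed

section \<open>A geodesic hull of a coarsely geodesic hyperbolic space\<close>

locale coarsely_geodesic_hyperbolic =
  fixes P :: "'a set" and e :: "'a \<Rightarrow> 'a \<Rightarrow> real" and c :: real
  assumes nonempty: "P \<noteq> {}"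
    and nonneg: "\<And>x y. 0 \<le> e x y"
    and refl: "\<And>x. x \<in> P \<Longrightarrow> e x x = 0"
    and sym: "\<And>x y. \<lbrakk>x \<in> P; y \<in> P\<rbrakk> \<Longrightarrow> e x y = e y x"
    and triangle: "\<And>x y z. \<lbrakk>x \<in> P; y \<in> P; z \<in> P\<rbrakk> \<Longrightarrow> e x z \<le> e x y + e y z"
    and hyperbolic: "four_point P e c"
    and coarsely_geodesic: "\<And>x y t. \<lbrakk>x \<in> P; y \<in> P; 0 \<le> t; t \<le> e x y\<rbrakk> \<Longrightarrow>
      \<exists>z\<in>P. e x z \<le> t \<and> e z y \<le> e x y - t + 1"
begin

text \<open>Two inequalities that hold for distance functions \<open>e p\<close>, and for Busemann functions, and that
  survive maxima and additive constants.\<close>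

definition busemann_like :: "('a \<Rightarrow> real) \<Rightarrow> bool" where
  "busemann_like f \<longleftrightarrow> (\<forall>u\<in>P. \<forall>v\<in>P. f u \<le> f v + e u v) \<and>
     (\<forall>u\<in>P. \<forall>v\<in>P. \<forall>z\<in>P. f z + e u v \<le> max (f u + e z v) (f v + e z u) + c)"

text \<open>Functions matter up to additive constants only; infimum 0 selects a representative without
  reference to a base point, so that isometries act by mere translation.\<close>

definition tree_hull :: "('a \<Rightarrow> real) set" where
  "tree_hull = {f \<in> extensional P. busemann_like f \<and> (\<forall>u\<in>P. 0 \<le> f u) \<and> (\<forall>\<epsilon>>0. \<exists>u\<in>P. f u < \<epsilon>)}"

definition sup_diff :: "('a \<Rightarrow> real) \<Rightarrow> ('a \<Rightarrow> real) \<Rightarrow> real" where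
  "sup_diff f g = (SUP u\<in>P. f u - g u)"

text \<open>The tropical projective metric. The maximum with 0 makes it nonnegative also for pairs of functions
  with unbounded difference, where the suprema are arbitrary.\<close>

definition hdist :: "('a \<Rightarrow> real) \<Rightarrow> ('a \<Rightarrow> real) \<Rightarrow> real" where
  "hdist f g = max 0 (sup_diff f g + sup_diff g f)"

definition point :: "'a \<Rightarrow> 'a \<Rightarrow> real" where "point p = restrict (e p) P"

definition normalise :: "('a \<Rightarrow> real) \<Rightarrow> 'a \<Rightarrow> real" where
  "normalise f = (\<lambda>u\<in>P. f u - (INF v\<in>P. f v))"

lemma c_nonneg: "0 \<le> c"
proof -
  obtain x where "x \<in> P" using nonempty by blast
  then show ?thesis using four_pointD[OF hyperbolic, of x x x x] refl by simp
qed

lemma busemann_like_lipschitz: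
  "busemann_like f \<Longrightarrow> u \<in> P \<Longrightarrow> v \<in> P \<Longrightarrow> f u \<le> f v + e u v"
  by (simp add: busemann_like_def)

lemma busemann_like_four_point:
  "busemann_like f \<Longrightarrow> u \<in> P \<Longrightarrow> v \<in> P \<Longrightarrow> z \<in> P \<Longrightarrow>
    f z + e u v \<le> max (f u + e z v) (f v + e z u) + c"
  by (simp add: busemann_like_def)

lemma busemann_like_max:
  assumes f: "busemann_like f" and g: "busemann_like g"
  shows "busemann_like (\<lambda>u. max (f u) (g u))"
  unfolding busemann_like_def
proof (intro conjI ballI)
  fix u v assume "u \<in> P" "v \<in> P"
  then show "max (f u) (g u) \<le> max (f v) (g v) + e u v"
    using busemann_like_lipschitz[OF f, of u v] busemann_like_lipschitz[OF g, of u v] by auto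
next
  fix u v z assume "u \<in> P" "v \<in> P" "z \<in> P"
  then show "max (f z) (g z) + e u v
      \<le> max (max (f u) (g u) + e z v) (max (f v) (g v) + e z u) + c"
    using busemann_like_four_point[OF f, of u v z] busemann_like_four_point[OF g, of u v z]
    by (auto simp: max_def split: if_splits)
qed

lemma busemann_like_shift:
  assumes "busemann_like f" "\<And>u. u \<in> P \<Longrightarrow> h u = f u - k"
  shows "busemann_like h"
  unfolding busemann_like_def
proof (intro conjI ballI)
  fix u v assume "u \<in> P" "v \<in> P"
  then show "h u \<le> h v + e u v" using busemann_like_lipschitz[OF assms(1)] assms(2) by simp
next
  fix u v z assume "u \<in> P" "v \<in> P" "z \<in> P"
  then show "h z + e u v \<le> max (h u + e z v) (h v + e z u) + c"
    using busemann_like_four_point[OF assms(1), of u v z] assms(2)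
    by (auto simp: max_def split: if_splits)
qed

lemma hullD:
  assumes "f \<in> tree_hull"
  shows "f \<in> extensional P" "busemann_like f" "\<And>u. u \<in> P \<Longrightarrow> 0 \<le> f u"
    "\<And>\<epsilon>. 0 < \<epsilon> \<Longrightarrow> \<exists>u\<in>P. f u < \<epsilon>"
  using assms by (auto simp: tree_hull_def)

lemma point_in_hull:
  assumes "p \<in> P"
  shows "point p \<in> tree_hull"
proof -
  have "busemann_like (point p)"
    unfolding busemann_like_def
  proof (intro conjI ballI)
    fix u v assume "u \<in> P" "v \<in> P"
    then show "point p u \<le> point p v + e u v"
      using triangle[of p v u] sym assms by (simp add: point_def)
  next
    fix u v z assume "u \<in> P" "v \<in> P" "z \<in> P"
    then show "point p z + e u v \<le> max (point p u + e z v) (point p v + e z u) + c"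
      using four_pointD[OF hyperbolic, of p u z v] assms sym[of u z] by (auto simp: point_def)
  qed
  moreover have "point p p = 0" using assms refl by (simp add: point_def)
  ultimately show ?thesis using assms nonneg by (auto simp: tree_hull_def point_def intro!: bexI[of _ p])
qed

lemma normalise_in_hull:
  assumes "busemann_like f" "\<And>u. u \<in> P \<Longrightarrow> b \<le> f u"
  shows "normalise f \<in> tree_hull"
proof -
  have bdd: "bdd_below (f ` P)" using assms(2) by (rule bdd_belowI2)
  have "busemann_like (normalise f)"
    by (rule busemann_like_shift[OF assms(1), where k = "INF v\<in>P. f v"]) (simp add: normalise_def)
  moreover have "0 \<le> normalise f u" if "u \<in> P" for u
    using cINF_lower[OF bdd that] that by (simp add: normalise_def)
  moreover have "\<exists>u\<in>P. normalise f u < \<epsilon>" if "0 < \<epsilon>" for \<epsilon>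
  proof -
    have "(INF v\<in>P. f v) < (INF v\<in>P. f v) + \<epsilon>" using that by simp
    then obtain u where "u \<in> P" "f u < (INF v\<in>P. f v) + \<epsilon>"
      using cINF_less_iff[OF nonempty bdd] by blast
    then show ?thesis by (intro bexI[of _ u]) (auto simp: normalise_def)
  qed
  ultimately show ?thesis by (auto simp: tree_hull_def normalise_def)
qed

lemma normalise_of_shift:
  assumes "f \<in> tree_hull" "\<And>u. u \<in> P \<Longrightarrow> h u = f u + k"
  shows "normalise h = f"
proof -
  have "(INF v\<in>P. h v) = k"
  proof (rule antisym)
    show "(INF v\<in>P. h v) \<le> k"
    proof (rule field_le_epsilon)
      fix \<epsilon> :: real assume "0 < \<epsilon>"
      then obtain u where "u \<in> P" "f u < \<epsilon>" using hullD(4)[OF assms(1)] by blast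
      moreover have "bdd_below (h ` P)"
        using assms hullD(3) by (intro bdd_belowI2[of _ k]) auto
      ultimately show "(INF v\<in>P. h v) \<le> k + \<epsilon>"
        using cINF_lower[of h P u] assms(2)[of u] by simp
    qed
    show "k \<le> (INF v\<in>P. h v)"
      using assms hullD(3) by (intro cINF_greatest[OF nonempty]) auto
  qed
  then have "normalise h u = f u" for u
    using assms(2) hullD(1)[OF assms(1)] by (cases "u \<in> P") (auto simp: normalise_def extensional_def)
  then show ?thesis by blast
qed

text \<open>Moving a little away from an almost minimum \<open>p\<close> of \<open>f\<close> towards \<open>u\<close> cannot decrease \<open>f\<close>
  much; by the four-point condition \<open>f\<close> then has to grow at unit speed up to \<open>u\<close>. The step length
  \<open>c + 3\<close> is large enough to exclude the first term of the maximum.\<close>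

lemma hull_near_point:
  assumes f: "f \<in> tree_hull"
  obtains p where "p \<in> P" "\<And>u. u \<in> P \<Longrightarrow> f u \<le> e p u + 1" "\<And>u. u \<in> P \<Longrightarrow> e p u \<le> f u + 2 * c + 3"
proof -
  obtain p where p: "p \<in> P" "f p < 1" using hullD(4)[OF f, of 1] by auto
  have "f u \<le> e p u + 1" if "u \<in> P" for u
    using busemann_like_lipschitz[OF hullD(2)[OF f] that p(1)] p(2) sym[OF that p(1)] by simp
  moreover have "e p u \<le> f u + 2 * c + 3" if u: "u \<in> P" for u
  proof (cases "e p u < c + 3")
    case True
    then show ?thesis using hullD(3)[OF f u] c_nonneg by simp
  next
    case False
    then obtain z where z: "z \<in> P" "e p z \<le> c + 3" "e z u \<le> e p u - (c + 3) + 1"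
      using coarsely_geodesic[OF p(1) u, of "c + 3"] c_nonneg by auto
    have "f z + e p u \<le> max (f p + e z u) (f u + e z p) + c"
      using busemann_like_four_point[OF hullD(2)[OF f] p(1) u z(1)] .
    then show ?thesis
      using z hullD(3)[OF f z(1)] p(2) sym[OF p(1) z(1)]
      by (auto simp: max_def split: if_splits)
  qed
  ultimately show thesis using that p(1) by blast
qed

lemma bdd_above_diff:
  assumes "f \<in> tree_hull" "g \<in> tree_hull"
  shows "bdd_above ((\<lambda>u. f u - g u) ` P)"
proof -
  obtain p where p: "p \<in> P" "\<And>u. u \<in> P \<Longrightarrow> f u \<le> e p u + 1"
    by (rule hull_near_point[OF assms(1)]) (rule that; blast)
  obtain q where q: "q \<in> P" "\<And>u. u \<in> P \<Longrightarrow> e q u \<le> g u + 2 * c + 3"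
    by (rule hull_near_point[OF assms(2)]) (rule that; blast)
  have "f u - g u \<le> e p q + 2 * c + 4" if "u \<in> P" for u
    using p(2)[OF that] q(2)[OF that] triangle[OF p(1) q(1) that] by simp
  then show ?thesis by (rule bdd_aboveI2)
qed

lemma sup_diff_upper: "f \<in> tree_hull \<Longrightarrow> g \<in> tree_hull \<Longrightarrow> u \<in> P \<Longrightarrow> f u - g u \<le> sup_diff f g"
  unfolding sup_diff_def using bdd_above_diff by (rule cSUP_upper2) auto

lemma sup_diff_le: "(\<And>u. u \<in> P \<Longrightarrow> f u - g u \<le> a) \<Longrightarrow> sup_diff f g \<le> a"
  unfolding sup_diff_def by (rule cSUP_least[OF nonempty])

lemma hdist_le:
  assumes "\<And>u. u \<in> P \<Longrightarrow> f u - g u \<le> a" "\<And>u. u \<in> P \<Longrightarrow> g u - f u \<le> b"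
  shows "hdist f g \<le> a + b"
proof -
  obtain u where "u \<in> P" using nonempty by blast
  then have "0 \<le> a + b" using assms[of u] by simp
  then show ?thesis
    using sup_diff_le[of f g a] sup_diff_le[of g f b] assms by (auto simp: hdist_def)
qed

lemma hdist_ge:
  assumes "f \<in> tree_hull" "g \<in> tree_hull" "u \<in> P" "v \<in> P"
  shows "(f u - g u) + (g v - f v) \<le> hdist f g"
  using sup_diff_upper[of f g u] sup_diff_upper[of g f v] assms by (simp add: hdist_def)

lemma hdist_eq:
  assumes "f \<in> tree_hull" "g \<in> tree_hull"
  shows "hdist f g = sup_diff f g + sup_diff g f"
proof -
  obtain u where "u \<in> P" using nonempty by blast
  then show ?thesis
    using sup_diff_upper[of f g u] sup_diff_upper[of g f u] assms by (simp add: hdist_def)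
qed

lemma hull_differ_by_constant:
  assumes "f \<in> tree_hull" "g \<in> tree_hull" "\<And>u. u \<in> P \<Longrightarrow> f u = g u + k"
  shows "f = g"
proof -
  have "normalise f = g" "normalise f = f"
    using normalise_of_shift[OF assms(2), of f k] normalise_of_shift[OF assms(1), of f 0] assms(3)
    by auto
  then show ?thesis by simp
qed

lemma Metric_space_hull: "Metric_space tree_hull hdist"
proof
  show "0 \<le> hdist f g" for f g by (simp add: hdist_def)
  show "hdist f g = hdist g f" for f g by (simp add: hdist_def add.commute)
next
  fix f g assume fg: "f \<in> tree_hull" "g \<in> tree_hull"
  show "hdist f g = 0 \<longleftrightarrow> f = g"
  proof
    assume 0: "hdist f g = 0"
    obtain v where v: "v \<in> P" using nonempty by blast
    have "f u = g u + (f v - g v)" if "u \<in> P" for u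
      using hdist_ge[OF fg that v] hdist_ge[OF fg v that] 0 by simp
    then show "f = g" using hull_differ_by_constant[OF fg] by blast
  next
    assume "f = g"
    then show "hdist f g = 0" using nonempty by (simp add: hdist_def sup_diff_def)
  qed
next
  fix f g h assume fgh: "f \<in> tree_hull" "g \<in> tree_hull" "h \<in> tree_hull"
  have "hdist f h \<le> (sup_diff f g + sup_diff g h) + (sup_diff h g + sup_diff g f)"
  proof (rule hdist_le)
    fix u assume "u \<in> P"
    then show "f u - h u \<le> sup_diff f g + sup_diff g h" "h u - f u \<le> sup_diff h g + sup_diff g f"
      using sup_diff_upper[of f g u] sup_diff_upper[of g h u] sup_diff_upper[of h g u]
        sup_diff_upper[of g f u] fgh by auto
  qed
  then show "hdist f h \<le> hdist f g + hdist g h" using fgh by (simp add: hdist_eq)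
qed

sublocale tree_hull: Metric_space tree_hull hdist
  by (rule Metric_space_hull)

abbreviation hull_metric :: "('a \<Rightarrow> real) metric" where "hull_metric \<equiv> metric (tree_hull, hdist)"

lemma hdist_points:
  assumes "p \<in> P" "q \<in> P"
  shows "hdist (point p) (point q) = 2 * e p q"
proof (rule antisym)
  have "hdist (point p) (point q) \<le> e p q + e p q"
  proof (rule hdist_le)
    fix u assume "u \<in> P"
    then show "point p u - point q u \<le> e p q" "point q u - point p u \<le> e p q"
      using triangle[of p q u] triangle[of q p u] sym[of p q] assms by (auto simp: point_def)
  qed
  then show "hdist (point p) (point q) \<le> 2 * e p q" by simp
  show "2 * e p q \<le> hdist (point p) (point q)"
    using hdist_ge[OF point_in_hull point_in_hull, of p q q p] assms refl sym[of p q]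
    by (simp add: point_def)
qed

lemma hull_coarsely_dense:
  assumes "f \<in> tree_hull"
  shows "\<exists>p\<in>P. hdist f (point p) \<le> 2 * c + 4"
proof -
  obtain p where p: "p \<in> P" "\<And>u. u \<in> P \<Longrightarrow> f u \<le> e p u + 1"
    "\<And>u. u \<in> P \<Longrightarrow> e p u \<le> f u + 2 * c + 3"
    by (rule hull_near_point[OF assms]) (rule that; blast)
  have "hdist f (point p) \<le> 1 + (2 * c + 3)"
    using p by (intro hdist_le) (fastforce simp: point_def)+
  then show ?thesis using p(1) by force
qed

text \<open>Each of the four distances changes by at most \<open>2 * (2 * c + 4)\<close> when the functions are replaced by
  nearby distance functions, for which \<open>hdist\<close> is twice \<open>e\<close>.\<close>

lemma hull_four_point: "four_point tree_hull hdist (18 * c + 32)"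
  unfolding four_point_def
proof (intro ballI)
  define B where "B = 2 * c + 4"
  fix f g h k assume m: "f \<in> tree_hull" "g \<in> tree_hull" "h \<in> tree_hull" "k \<in> tree_hull"
  obtain p q r s where n: "p \<in> P" "q \<in> P" "r \<in> P" "s \<in> P" "hdist f (point p) \<le> B"
    "hdist g (point q) \<le> B" "hdist h (point r) \<le> B" "hdist k (point s) \<le> B"
    using m hull_coarsely_dense unfolding B_def by meson
  have close: "\<bar>hdist a b - 2 * e x y\<bar> \<le> 2 * B"
    if "a \<in> tree_hull" "b \<in> tree_hull" "x \<in> P" "y \<in> P" "hdist a (point x) \<le> B" "hdist b (point y) \<le> B"
    for a b x y
    using tree_hull.triangle[of a "point x" b] tree_hull.triangle[of "point x" "point y" b]
      tree_hull.triangle[of "point x" a "point y"] tree_hull.triangle[of a b "point y"]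
      tree_hull.commute[of "point x" a] tree_hull.commute[of b "point y"] hdist_points[of x y]
      that point_in_hull by (simp add: abs_le_iff)
  have "e p r + e q s \<le> max (e p q + e r s) (e q r + e p s) + c"
    using four_pointD[OF hyperbolic n(1-4)] .
  then show "hdist f h + hdist g k \<le> max (hdist f g + hdist h k) (hdist g h + hdist f k) + (18 * c + 32)"
    using close[of f h p r] close[of g k q s] close[of f g p q] close[of h k r s]
      close[of g h q r] close[of f k p s] m n
    by (auto simp: B_def max_def abs_le_iff split: if_splits)
qed

text \<open>The functions \<open>max (f - r) g\<close> go, up to constants, from \<open>f\<close> at \<open>r = - sup (g - f)\<close> to \<open>g\<close> at
  \<open>r = sup (f - g)\<close>. Raising \<open>r\<close> by some amount lowers the function by between 0 and this amount, so
  the path is 1-Lipschitz, and its length is the distance of its ends.\<close>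

lemma hull_geodesic_path:
  assumes f: "f \<in> tree_hull" and g: "g \<in> tree_hull"
  shows "\<exists>\<gamma>. geodesic_path hull_metric \<gamma> (hdist f g) \<and> \<gamma> 0 = f \<and> \<gamma> (hdist f g) = g"
proof -
  define l where "l = hdist f g"
  define b where "b = sup_diff g f"
  define H where "H s u = max (f u - (s - b)) (g u)" for s u
  define \<gamma> where "\<gamma> s = normalise (H s)" for s
  have l: "l = sup_diff f g + b" using hdist_eq[OF f g] by (simp add: l_def b_def)
  have mem: "\<gamma> s \<in> tree_hull" for s
    unfolding \<gamma>_def
  proof (rule normalise_in_hull)
    have "busemann_like (\<lambda>u. f u - (s - b))"
      by (rule busemann_like_shift[OF hullD(2)[OF f]]) (rule HOL.refl)
    then show "busemann_like (H s)"
      using hullD(2)[OF g] unfolding H_def by (rule busemann_like_max)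
    show "0 \<le> H s u" if "u \<in> P" for u using hullD(3)[OF g that] by (simp add: H_def)
  qed
  have 0: "\<gamma> 0 = f"
    unfolding \<gamma>_def
  proof (rule normalise_of_shift[OF f])
    show "H 0 u = f u + b" if "u \<in> P" for u
      using sup_diff_upper[OF g f that] by (simp add: H_def b_def)
  qed
  have 1: "\<gamma> l = g"
    unfolding \<gamma>_def
  proof (rule normalise_of_shift[OF g])
    show "H l u = g u + 0" if "u \<in> P" for u
      using sup_diff_upper[OF f g that] l by (simp add: H_def)
  qed
  have le: "hdist (\<gamma> s) (\<gamma> t) \<le> t - s" if "s \<le> t" for s t
  proof -
    define k where "k = (INF u\<in>P. H s u) - (INF u\<in>P. H t u)"
    have "hdist (\<gamma> s) (\<gamma> t) \<le> (t - s - k) + k"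
    proof (rule hdist_le)
      fix u assume "u \<in> P"
      then show "\<gamma> s u - \<gamma> t u \<le> t - s - k" "\<gamma> t u - \<gamma> s u \<le> k"
        using that by (auto simp: \<gamma>_def normalise_def k_def H_def max_def)
    qed
    then show ?thesis by simp
  qed
  have dist: "hdist (\<gamma> s) (\<gamma> t) = t - s" if "0 \<le> s" "s \<le> t" "t \<le> l" for s t
    using le[of 0 s] le[of s t] le[of t l] that tree_hull.triangle[OF mem[of 0] mem[of s] mem[of l]]
      tree_hull.triangle[OF mem[of s] mem[of t] mem[of l]] 0 1 by (simp add: l_def)
  have "hdist (\<gamma> s) (\<gamma> t) = \<bar>s - t\<bar>" if "s \<in> {0..l}" "t \<in> {0..l}" for s t
    using dist[of s t] dist[of t s] that tree_hull.commute[of "\<gamma> s" "\<gamma> t"] by (cases "s \<le> t") auto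
  then have "geodesic_path hull_metric \<gamma> l"
    using mem by (auto simp: geodesic_path_def l_def)
  then show ?thesis using 0 1 unfolding l_def by blast
qed

lemma hyperbolic_space_hull: "hyperbolic_space hull_metric"
proof -
  have "geodesic_metric hull_metric"
    unfolding geodesic_metric_def geodesic_between_iff_path tree_hull.mspace_metric
    using hull_geodesic_path by blast
  moreover have "gromov_hyperbolic hull_metric"
    unfolding gromov_hyperbolic_iff_four_point using hull_four_point by auto
  ultimately show ?thesis by (simp add: hyperbolic_space_def)
qed

end

section \<open>The induced action on the hull\<close>

locale hull_action = coarsely_geodesic_hyperbolic P e c + group_action G P \<phi>
  for P :: "'a set" and e c and G (structure) and \<phi> +
  assumes invariant: "\<And>g x y. \<lbrakk>g \<in> carrier G; x \<in> P; y \<in> P\<rbrakk> \<Longrightarrow> e (\<phi> g x) (\<phi> g y) = e x y"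
begin

definition translate :: "'b \<Rightarrow> ('a \<Rightarrow> real) \<Rightarrow> 'a \<Rightarrow> real" where
  "translate g = (\<lambda>f\<in>tree_hull. \<lambda>u\<in>P. f (\<phi> (inv g) u))"

lemma is_group: "group G"
  using group_hom by (rule group_hom.axioms(1))

lemma inv_in_carrier: "g \<in> carrier G \<Longrightarrow> inv g \<in> carrier G"
  using is_group by (rule group.inv_closed)

lemma act_mem: "g \<in> carrier G \<Longrightarrow> x \<in> P \<Longrightarrow> \<phi> g x \<in> P"
  using element_image by blast

lemma inv_act: "g \<in> carrier G \<Longrightarrow> x \<in> P \<Longrightarrow> \<phi> (inv g) (\<phi> g x) = x"
  using orbit_sym_aux by blast

lemma act_inv: "g \<in> carrier G \<Longrightarrow> x \<in> P \<Longrightarrow> \<phi> g (\<phi> (inv g) x) = x"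
  using inv_act[of "inv g" x] inv_in_carrier group.inv_inv[OF is_group] by simp

lemma translate_apply:
  "f \<in> tree_hull \<Longrightarrow> u \<in> P \<Longrightarrow> translate g f u = f (\<phi> (inv g) u)"
  by (simp add: translate_def)

lemma translate_in_hull:
  assumes g: "g \<in> carrier G" and f: "f \<in> tree_hull"
  shows "translate g f \<in> tree_hull"
proof -
  let ?h = "\<phi> (inv g)"
  have h: "?h u \<in> P" if "u \<in> P" for u using act_mem inv_in_carrier g that by blast
  have e: "e (?h u) (?h v) = e u v" if "u \<in> P" "v \<in> P" for u v
    using invariant[OF inv_in_carrier[OF g] that] .
  have "busemann_like (translate g f)"
    unfolding busemann_like_def
  proof (intro conjI ballI)
    fix u v assume "u \<in> P" "v \<in> P"
    then show "translate g f u \<le> translate g f v + e u v"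
      using busemann_like_lipschitz[OF hullD(2)[OF f] h h, of u v] e f by (simp add: translate_apply)
  next
    fix u v z assume "u \<in> P" "v \<in> P" "z \<in> P"
    then show "translate g f z + e u v
        \<le> max (translate g f u + e z v) (translate g f v + e z u) + c"
      using busemann_like_four_point[OF hullD(2)[OF f] h h h, of u v z] e f
      by (simp add: translate_apply)
  qed
  moreover have "\<exists>u\<in>P. translate g f u < \<epsilon>" if \<epsilon>: "0 < \<epsilon>" for \<epsilon>
  proof -
    obtain u where "u \<in> P" "f u < \<epsilon>" using hullD(4)[OF f \<epsilon>] by blast
    then show ?thesis
      using f g act_mem inv_act by (intro bexI[of _ "\<phi> g u"]) (simp_all add: translate_apply)
  qed
  moreover have "translate g f \<in> extensional P" using f by (simp add: translate_def)
  moreover have "0 \<le> translate g f u" if "u \<in> P" for u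
    using hullD(3)[OF f h[OF that]] f that by (simp add: translate_apply)
  ultimately show ?thesis by (auto simp: tree_hull_def)
qed

lemma hull_eqI:
  assumes "f \<in> tree_hull" "f' \<in> tree_hull" "\<And>u. u \<in> P \<Longrightarrow> f u = f' u"
  shows "f = f'"
  using assms hull_differ_by_constant[of f f' 0] by simp

lemma translate_mult:
  assumes "g \<in> carrier G" "h \<in> carrier G" "f \<in> tree_hull"
  shows "translate (g \<otimes> h) f = translate g (translate h f)"
proof (rule hull_eqI)
  have gh: "g \<otimes> h \<in> carrier G"
    using assms is_group by (simp add: group.subgroup_self subgroup.m_closed)
  show "translate (g \<otimes> h) f \<in> tree_hull" "translate g (translate h f) \<in> tree_hull"
    using translate_in_hull assms gh by auto
  show "translate (g \<otimes> h) f u = translate g (translate h f) u" if u: "u \<in> P" for u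
  proof -
    have "\<phi> (inv (g \<otimes> h)) u = \<phi> (inv h) (\<phi> (inv g) u)"
      using composition_rule[OF u inv_in_carrier[OF assms(2)] inv_in_carrier[OF assms(1)]]
        group.inv_mult_group[OF is_group assms(1,2)] by simp
    moreover have "\<phi> (inv g) u \<in> P" using act_mem inv_in_carrier assms(1) u by blast
    ultimately show ?thesis
      using assms u translate_in_hull[OF assms(2,3)] by (simp add: translate_apply)
  qed
qed

lemma translate_inv:
  assumes "g \<in> carrier G" "f \<in> tree_hull"
  shows "translate (inv g) (translate g f) = f" "translate g (translate (inv g) f) = f"
proof -
  have g: "inv g \<in> carrier G" "inv (inv g) = g"
    using inv_in_carrier group.inv_inv[OF is_group] assms(1) by auto
  show "translate (inv g) (translate g f) = f"
    using assms g act_mem inv_act translate_in_hull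
    by (intro hull_eqI) (auto simp: translate_apply)
  show "translate g (translate (inv g) f) = f"
    using assms g act_mem act_inv translate_in_hull
    by (intro hull_eqI) (auto simp: translate_apply)
qed

lemma translate_hdist:
  assumes g: "g \<in> carrier G" and f: "f \<in> tree_hull" "f' \<in> tree_hull"
  shows "hdist (translate g f) (translate g f') = hdist f f'"
proof -
  have "sup_diff (translate g a) (translate g b) = sup_diff a b"
    if "a \<in> tree_hull" "b \<in> tree_hull" for a b
  proof -
    have "(\<lambda>u. translate g a u - translate g b u) ` P = (\<lambda>u. a u - b u) ` \<phi> (inv g) ` P"
      using that by (force simp: translate_apply)
    then show ?thesis
      unfolding sup_diff_def using surj_prop[OF inv_in_carrier[OF g]] by simp
  qed
  then show ?thesis using f by (simp add: hdist_def)
qed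

lemma isometric_action_translate: "isometric_action G hull_metric translate"
proof -
  have bij: "translate g \<in> Bij tree_hull" if "g \<in> carrier G" for g
  proof -
    have "bij_betw (translate g) tree_hull tree_hull"
      using translate_inv[OF that] translate_in_hull[OF that]
        translate_in_hull[OF inv_in_carrier[OF that]]
      by (intro bij_betw_byWitness[where f' = "translate (inv g)"]) auto
    then show ?thesis by (simp add: Bij_def translate_def)
  qed
  have "group_hom G (BijGroup tree_hull) translate"
  proof (intro group_hom.intro is_group group_BijGroup group_hom_axioms.intro homI)
    show "translate g \<in> carrier (BijGroup tree_hull)" if "g \<in> carrier G" for g
      using bij[OF that] by (simp add: BijGroup_def)
    show "translate (g \<otimes> h) = translate g \<otimes>\<^bsub>BijGroup tree_hull\<^esub> translate h"
      if "g \<in> carrier G" "h \<in> carrier G" for g h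
    proof -
      have "translate (g \<otimes> h) f = compose tree_hull (translate g) (translate h) f" for f
        using translate_mult[OF that] by (cases "f \<in> tree_hull") (auto simp: compose_def translate_def)
      then show ?thesis using bij that by (auto simp: BijGroup_def)
    qed
  qed
  then show ?thesis
    using translate_hdist by (simp add: isometric_action_def group_action_def)
qed

lemma translate_point:
  assumes "g \<in> carrier G" "p \<in> P"
  shows "translate g (point p) = point (\<phi> g p)"
proof (rule hull_eqI)
  show "translate g (point p) \<in> tree_hull" "point (\<phi> g p) \<in> tree_hull"
    using assms translate_in_hull point_in_hull act_mem by auto
  show "translate g (point p) u = point (\<phi> g p) u" if u: "u \<in> P" for u
  proof -
    have "e p (\<phi> (inv g) u) = e (\<phi> g p) u"
      using invariant[of g p "\<phi> (inv g) u"] act_mem inv_in_carrier act_inv assms u by simp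
    then show ?thesis
      using assms u point_in_hull act_mem inv_in_carrier by (simp add: translate_apply point_def)
  qed
qed

end

section \<open>Hausdorff distance\<close>

lemma hausdorff_dist_le:
  assumes "\<And>a. a \<in> A \<Longrightarrow> \<exists>b\<in>B. mdist X a b \<le> D" "\<And>b. b \<in> B \<Longrightarrow> \<exists>a\<in>A. mdist X b a \<le> D"
  shows "hausdorff_dist X A B \<le> ennreal D"
proof -
  have "dist_to_set X a B \<le> ennreal D" if "\<exists>b\<in>B. mdist X a b \<le> D" for a and B
    unfolding dist_to_set_def using that by (meson INF_lower2 ennreal_leI)
  then show ?thesis unfolding hausdorff_dist_def using assms by (auto intro!: SUP_least)
qed

lemma neighbourhood_obtains:
  assumes "x \<in> neighbourhood X r A" "0 \<le> r" "0 < \<epsilon>"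
  obtains a where "a \<in> A" "mdist X x a < r + \<epsilon>"
proof -
  have "dist_to_set X x A < ennreal (r + \<epsilon>)"
    using assms by (auto simp: neighbourhood_def ennreal_less_iff intro: le_less_trans)
  then obtain a where "a \<in> A" "ennreal (mdist X x a) < ennreal (r + \<epsilon>)"
    unfolding dist_to_set_def INF_less_iff by blast
  then show thesis using that by (simp add: ennreal_less_iff del: ennreal_plus)
qed

section \<open>Coning off geodesics far from an orbit\<close>

theorem propositionA1:
  fixes G :: "('g, 'm) monoid_scheme" and X :: "'a metric" and \<phi> :: "'g \<Rightarrow> 'a \<Rightarrow> 'a"
    and x0 :: 'a and Q :: real
  assumes "hyperbolic_space X"
    and "isometric_action G X \<phi>"
    and "x0 \<in> mspace X"
    and "0 \<le> Q"
  shows "\<exists>(K::real) (Y :: ('a \<Rightarrow> real) metric) \<psi> \<pi>.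
      K > 0 \<and> hyperbolic_space Y \<and> cobounded_action G Y \<psi> \<and>
      equivariant G X \<phi> \<psi> \<pi> \<and> coarsely_lipschitz X Y \<pi> \<and>
      (\<forall>Z. quasiconvex X Q Z \<and> Z \<subseteq> orbit G \<phi> x0 \<longrightarrow>
         quasi_isometric_embedding K (submetric X Z) Y \<pi>) \<and>
      (\<exists>D::real. \<forall>x\<in>mspace X. \<forall>y\<in>mspace X. \<forall>S T.
         geodesic_between X x y S \<and> geodesic_between Y (\<pi> x) (\<pi> y) T \<longrightarrow>
           hausdorff_dist Y (\<pi> ` S) T \<le> ennreal D)"
proof -
  obtain \<delta> where \<delta>: "four_point (mspace X) (mdist X) \<delta>"
    using assms(1) by (auto simp: hyperbolic_space_def gromov_hyperbolic_iff_four_point)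
  have \<delta>0: "0 \<le> \<delta>" using four_point_nonneg[OF \<delta> assms(3)] .
  interpret act: group_action G "mspace X" \<phi>
    using assms(2) by (simp add: isometric_action_def)
  have isom: "mdist X (\<phi> g x) (\<phi> g y) = mdist X x y"
    if "g \<in> carrier G" "x \<in> mspace X" "y \<in> mspace X" for g x y
    using assms(2) that by (simp add: isometric_action_def)
  define A where "A = orbit G \<phi> x0"
  have A: "x0 \<in> A" "A \<subseteq> mspace X"
    using act.orbit_refl[OF assms(3)] act.element_image[OF _ assms(3)] by (auto simp: A_def orbit_def)
  \<comment> \<open>points \<open>Q + 1\<close>-close to the orbit are further than \<open>3 * \<delta>\<close> from the region coned off\<close>
  define R where "R = Q + 3 * \<delta> + 1"
  define U where "U = {z \<in> mspace X. \<forall>a\<in>A. R < mdist X z a}"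
  interpret electrification X \<delta> U
    using assms(1) \<delta> \<delta>0 by unfold_locales (auto simp: hyperbolic_space_def)

  have G: "group G" using act.group_hom by (rule group_hom.axioms(1))
  have act_mem: "\<phi> g x \<in> M" if "g \<in> carrier G" "x \<in> M" for g x
    using act.element_image that by blast
  have U_invariant: "\<phi> g z \<in> U" if g: "g \<in> carrier G" and z: "z \<in> U" "z \<in> M" for g z
  proof -
    have "R < mdist X (\<phi> g z) a" if a: "a \<in> A" for a
    proof -
      have "\<phi> (inv\<^bsub>G\<^esub> g) a \<in> A"
        using act.orbit_trans[of x0 a "\<phi> (inv\<^bsub>G\<^esub> g) a"] act_mem[of "inv\<^bsub>G\<^esub> g" a] a A g
          group.inv_closed[OF G] assms(3) by (auto simp: A_def orbit_def)
      then have "R < mdist X z (\<phi> (inv\<^bsub>G\<^esub> g) a)" using z by (simp add: U_def)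
      also have "\<dots> = mdist X (\<phi> g z) a"
        using isom[of "inv\<^bsub>G\<^esub> g" "\<phi> g z" a] act.orbit_sym_aux[OF g z(2)] act_mem a A g z
          group.inv_closed[OF G] by auto
      finally show ?thesis .
    qed
    then show ?thesis using act_mem g z by (simp add: U_def)
  qed
  have edist_act_le: "edist (\<phi> g x) (\<phi> g y) \<le> edist x y"
    if "g \<in> carrier G" "x \<in> M" "y \<in> M" for g x y
    using that act_mem isom U_invariant by (intro edist_isometry_le) auto
  have edist_invariant: "edist (\<phi> g x) (\<phi> g y) = edist x y"
    if "g \<in> carrier G" "x \<in> M" "y \<in> M" for g x y
    using edist_act_le[OF that] edist_act_le[of "inv\<^bsub>G\<^esub> g" "\<phi> g x" "\<phi> g y"] that act_mem
      act.orbit_sym_aux[OF that(1,2)] act.orbit_sym_aux[OF that(1,3)] group.inv_closed[OF G] by simp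

  obtain c where c: "four_point M (\<lambda>x y. real (edist x y)) c" using edist_four_point .
  interpret hull_action M "\<lambda>x y. real (edist x y)" c G \<phi>
    using assms(3) c edist_invariant edist_commute edist_triangle_real edist_coarsely_geodesic
    by unfold_locales auto
  define Y where "Y = hull_metric"
  have Y: "mspace Y = tree_hull" "mdist Y = hdist" by (simp_all add: Y_def)
  obtain cY where cY: "four_point (mspace Y) (mdist Y) cY" using hull_four_point Y by auto
  obtain C where C: "0 \<le> C" "\<And>x y q. \<lbrakk>x \<in> M; y \<in> M; q \<in> M\<rbrakk> \<Longrightarrow>
      real (edist x q) + real (edist q y) \<le> real (edist x y) + (d q x + d q y - d x y) + C"
    using edist_additive by blast

  have cobounded: "cobounded_action G Y translate"
  proof -
    have "hausdorff_dist Y (orbit G translate (point x0)) (mspace Y)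
        \<le> ennreal (2 * c + 4 + 2 * (R + 4))"
    proof (rule hausdorff_dist_le)
      fix f assume "f \<in> orbit G translate (point x0)"
      then have "f \<in> tree_hull"
        using translate_in_hull point_in_hull assms(3) by (auto simp: orbit_def)
      moreover have "0 \<le> 2 * c + 4 + 2 * (R + 4)"
        using c_nonneg assms(4) \<delta>0 by (simp add: R_def)
      ultimately show "\<exists>h\<in>mspace Y. mdist Y f h \<le> 2 * c + 4 + 2 * (R + 4)"
        using Y by (intro bexI[of _ f]) auto
    next
      fix f assume "f \<in> mspace Y"
      then have f: "f \<in> tree_hull" using Y by simp
      obtain p where p: "p \<in> M" "hdist f (point p) \<le> 2 * c + 4"
        using hull_coarsely_dense[OF f] by blast
      obtain a where a: "a \<in> A" "real (edist p a) \<le> R + 4"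
        using edist_to_avoided_set[of A p R] A p assms(4) \<delta>0 by (auto simp: U_def R_def)
      have "hdist f (point a) \<le> 2 * c + 4 + 2 * (R + 4)"
        using tree_hull.triangle[OF f point_in_hull point_in_hull, of p a] hdist_points[of p a]
          p a A by auto
      moreover have "point a \<in> orbit G translate (point x0)"
        using a(1) translate_point assms(3) unfolding A_def orbit_def by force
      ultimately show "\<exists>h\<in>orbit G translate (point x0). mdist Y f h \<le> 2 * c + 4 + 2 * (R + 4)"
        using Y by auto
    qed
    then have "hausdorff_dist Y (orbit G translate (point x0)) (mspace Y) < \<infinity>"
      by (simp add: le_less_trans)
    then show ?thesis
      using isometric_action_translate point_in_hull[OF assms(3)] Y
      by (auto simp: cobounded_action_def Y_def)
  qed

  have lipschitz: "mdist Y (point x) (point y) \<le> 2 * d x y + 2" if "x \<in> M" "y \<in> M" for x y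
    using hdist_points[OF that] edist_le[OF that] Y by simp
  have undistorted: "d a b \<le> (\<delta> + 1) * real (edist a b)"
    if Z: "quasiconvex X Q Z" "Z \<subseteq> A" and ab: "a \<in> Z" "b \<in> Z" for Z a b
  proof -
    have m: "a \<in> M" "b \<in> M" using that A by auto
    obtain \<gamma> where g: "geodesic_path X \<gamma> (d a b)" "\<gamma> 0 = a" "\<gamma> (d a b) = b"
      using geodesic_exists m by blast
    interpret electrified_geodesic X \<delta> U \<gamma> "d a b"
      by unfold_locales (rule g(1))
    have "d a b \<le> (\<delta> + 1) * real (edist (\<gamma> 0) (\<gamma> (d a b)))"
    proof (rule electrification_undistorted)
      fix s t assume s: "s \<in> U" "s \<in> M" and t: "0 \<le> t" "t \<le> d a b"
      have "geodesic_between X a b (\<gamma> ` {0..d a b})"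
        using g unfolding geodesic_between_iff_path by blast
      then have "\<gamma> ` {0..d a b} \<subseteq> neighbourhood X Q Z"
        using Z(1) ab unfolding quasiconvex_def by blast
      then have "\<gamma> t \<in> neighbourhood X Q Z" using t by auto
      then obtain z where z: "z \<in> Z" "d (\<gamma> t) z < Q + 1"
        using neighbourhood_obtains[OF _ assms(4), of "\<gamma> t" X Z 1] by auto
      have "R < d s z" using s z Z(2) by (auto simp: U_def)
      also have "\<dots> \<le> d s (\<gamma> t) + d (\<gamma> t) z"
        using mdist_triangle[OF s(2) path_mspace[OF t]] z Z(2) A by blast
      finally show "3 * \<delta> < d (\<gamma> t) s"
        using z(2) mdist_commute[of X s "\<gamma> t"] by (simp add: R_def)
    qed
    then show ?thesis using g by simp
  qed

  have qi: "quasi_isometric_embedding (\<delta> + 2) (submetric X Z) Y point"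
    if Z: "quasiconvex X Q Z" "Z \<subseteq> A" for Z
    unfolding quasi_isometric_embedding_def
  proof (intro conjI ballI)
    show "point \<in> mspace (submetric X Z) \<rightarrow> mspace Y" using point_in_hull Y by auto
    fix a b assume "a \<in> mspace (submetric X Z)" "b \<in> mspace (submetric X Z)"
    then have ab: "a \<in> Z" "b \<in> Z" "a \<in> M" "b \<in> M" by auto
    have "d a b \<le> (\<delta> + 2) * (2 * real (edist a b))"
    proof -
      have "d a b \<le> (\<delta> + 1) * real (edist a b)" using undistorted[OF Z ab(1,2)] .
      also have "\<dots> \<le> (\<delta> + 2) * (2 * real (edist a b))" using \<delta>0 by (intro mult_mono) auto
      finally show ?thesis .
    qed
    then have "1 / (\<delta> + 2) * d a b \<le> mdist Y (point a) (point b)"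
      using \<delta>0 hdist_points[OF ab(3,4)] Y by (simp add: field_simps)
    then show "1 / (\<delta> + 2) * mdist (submetric X Z) a b - (\<delta> + 2) \<le> mdist Y (point a) (point b)"
      using \<delta>0 by simp
    have "2 * d a b + 2 \<le> (\<delta> + 2) * d a b + (\<delta> + 2)"
      using \<delta>0 by (intro add_mono mult_right_mono) auto
    then show "mdist Y (point a) (point b) \<le> (\<delta> + 2) * mdist (submetric X Z) a b + (\<delta> + 2)"
      using lipschitz[OF ab(3,4)] by simp
  qed

  have geodesics: "hausdorff_dist Y (point ` S) T \<le> ennreal (4 + 2 * C + cY)"
    if xy: "x \<in> M" "y \<in> M" and S: "geodesic_between X x y S"
      and T: "geodesic_between Y (point x) (point y) T" for x y S T
  proof -
    obtain \<gamma> l where g: "geodesic_path X \<gamma> l" "\<gamma> 0 = x" "\<gamma> l = y" "S = \<gamma> ` {0..l}"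
      using S unfolding geodesic_between_iff_path by blast
    obtain \<tau> m where h: "geodesic_path Y \<tau> m" "\<tau> 0 = point x" "\<tau> m = point y" "T = \<tau> ` {0..m}"
      using T unfolding geodesic_between_iff_path by blast
    have m: "m = 2 * real (edist x y)"
      using geodesic_path_length[OF h(1)] h hdist_points[OF xy] Y by simp
    have gM: "\<gamma> t \<in> M" if "0 \<le> t" "t \<le> l" for t
      using geodesic_path_mspace[OF g(1) that] .
    have additive: "real (edist x (\<gamma> t)) + real (edist (\<gamma> t) y) \<le> real (edist x y) + C"
      if "0 \<le> t" "t \<le> l" for t
      using C(2)[OF xy gM[OF that]] geodesic_path_dist_left[OF g(1) that]
        geodesic_path_dist_right[OF g(1) that] geodesic_path_length[OF g(1)] g
        mdist_commute[of X x "\<gamma> t"] by simp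
    have dY: "mdist Y (point (\<gamma> t)) (\<tau> 0) = 2 * real (edist x (\<gamma> t))"
      "mdist Y (point (\<gamma> t)) (\<tau> m) = 2 * real (edist (\<gamma> t) y)" if "0 \<le> t" "t \<le> l" for t
      using hdist_points gM[OF that] xy h Y edist_commute[of x "\<gamma> t"] by auto
    have pY: "point (\<gamma> t) \<in> mspace Y" if "0 \<le> t" "t \<le> l" for t
      using point_in_hull gM[OF that] Y by simp
    show ?thesis
    proof (rule hausdorff_dist_le)
      fix a assume "a \<in> point ` S"
      then obtain t where t: "0 \<le> t" "t \<le> l" "a = point (\<gamma> t)" using g by auto
      obtain r where r: "0 \<le> r" "r \<le> m" "mdist Y (point (\<gamma> t)) (\<tau> r)
          \<le> (mdist Y (point (\<gamma> t)) (\<tau> 0) + mdist Y (point (\<gamma> t)) (\<tau> m) - m) / 2 + cY"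
        using point_near_geodesic[OF cY h(1) pY[OF t(1,2)]] .
      then have "mdist Y a (\<tau> r) \<le> C + cY"
        using additive[OF t(1,2)] dY[OF t(1,2)] m t(3) by (simp add: field_simps)
      then show "\<exists>b\<in>T. mdist Y a b \<le> 4 + 2 * C + cY"
        using h r C(1) by (intro bexI[of _ "\<tau> r"]) auto
    next
      fix b assume "b \<in> T"
      then obtain r where r: "0 \<le> r" "r \<le> m" "b = \<tau> r" using h by auto
      obtain t where t: "0 \<le> t" "t \<le> l" "\<bar>real (edist x (\<gamma> t)) - r / 2\<bar> \<le> 2"
        using edist_intermediate_value[OF g(1), of "r / 2"] g m r by auto
      have "mdist Y (point (\<gamma> t)) (\<tau> r)
          \<le> max (2 * real (edist x (\<gamma> t)) - r) (2 * real (edist (\<gamma> t) y) - (m - r)) + cY"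
        using dist_geodesic_point_le[OF cY h(1) r(1,2) pY[OF t(1,2)]] dY[OF t(1,2)] by simp
      also have "\<dots> \<le> 4 + 2 * C + cY"
        using additive[OF t(1,2)] t(3) m C(1) by (auto simp: max_def abs_le_iff)
      finally have "mdist Y b (point (\<gamma> t)) \<le> 4 + 2 * C + cY"
        using r(3) mdist_commute[of Y] by metis
      then show "\<exists>a\<in>point ` S. mdist Y b a \<le> 4 + 2 * C + cY" using g t by auto
    qed
  qed

  have "hyperbolic_space Y" using hyperbolic_space_hull by (simp add: Y_def)
  moreover have "equivariant G X \<phi> translate point"
    using translate_point by (simp add: equivariant_def)
  moreover have "coarsely_lipschitz X Y point"
    unfolding coarsely_lipschitz_def using lipschitz point_in_hull Y by blast
  moreover have "0 < \<delta> + 2" using \<delta>0 by simp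
  moreover have "\<forall>Z. quasiconvex X Q Z \<and> Z \<subseteq> orbit G \<phi> x0 \<longrightarrow>
      quasi_isometric_embedding (\<delta> + 2) (submetric X Z) Y point"
    using qi unfolding A_def by blast
  moreover have "\<exists>D. \<forall>x\<in>mspace X. \<forall>y\<in>mspace X. \<forall>S T.
      geodesic_between X x y S \<and> geodesic_between Y (point x) (point y) T \<longrightarrow>
        hausdorff_dist Y (point ` S) T \<le> ennreal D"
    using geodesics by blast
  ultimately show ?thesis using cobounded by blast
qed

end
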